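(* Let $T>0$. For every $\bar\mu_0\in\bar{\mathcal M}$, the fixed point equation $$\bar\mu_t=\bar\mu_0\circ T_{0,t}[W,\bar\mu_\cdot],\qquad t\in[0,T],$$ interpreted as $\mu_t^x=\mu_0^x\circ T^x_{0,t}[W,\bar\mu_\cdot]$ for a.e. $x\in I$ and all $t\in[0,T]$, has a unique solution $\bar\mu_\cdot\in\bar{\mathcal M}_{\mathcal T}$.
   Context: Let $I=[0,1]$, $\mathcal{T}=[0,T]$, $\mathbb{S}=\mathbb{R}/2\pi\mathbb{Z}$ with distance $d_{\mathbb S}(\theta,\theta')=\min\{|\theta-\theta'|,2\pi-|\theta-\theta'|\}$ (representatives in $[0,2\pi)$). $\mathcal{M}$ is the space of Borel probability measures on $\mathbb{S}$ with the metric $d(\mu,\eta)=\sup_{f\in\mathcal{L}}\left|\int_{\mathbb S}f\,d\mu-\int_{\mathbb S}f\,d\eta\right|$, where $\mathcal{L}$ is the set of real-valued Lipschitz functions on $\mathbb{S}$ with Lipschitz constant at most $1$. $\bar{\mathcal M}$ is the set of measurable functions $\bar\mu:I\to\mathcal{M}$, $x\mapsto\mu^x$ (preimages of open sets are Lebesgue measurable), with functions equal a.e. identified, with the metric $\bar d(\bar\mu,\bar\eta)=\int_Id(\mu^x,\eta^x)\,dx$. $\bar{\mathcal M}_{\mathcal T}=C(\mathcal{T},\bar{\mathcal M})$ is the space of continuous $\bar{\mathcal M}$-valued functions $\bar\mu_\cdot:t\mapsto\bar\mu_t$. Standing assumptions: $W:I^2\to\mathbb{R}$ is symmetric and measurable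 with $\sup_{I^2}|W|\le1$ and $\lim_{\delta\to0}\int_I|W(x+\delta,y)-W(x,y)|\,dy=0$ for all $x\in I$ (over $\delta$ with $x+\delta\in I$); $D:\mathbb{S}\to\mathbb{R}$ (a $2\pi$-periodic function) satisfies $\max|D|\le1$ and $|D(u)-D(v)|\le|u-v|$. For $\bar\mu_\cdot\in\bar{\mathcal M}_{\mathcal T}$ set $$V[W,\bar\mu_\cdot](u,x,t)=\int_IW(x,y)\left\{\int_{\mathbb S}D(v-u)\,d\mu_t^y(v)\right\}dy .$$ For each $x\in I$, $T^x_{t,s}[W,\bar\mu_\cdot]:\mathbb{S}\to\mathbb{S}$, $t,s\in\mathcal{T}$, denotes the flow of $\frac{d}{dt}u=V[W,\bar\mu_\cdot](u,x,t)$: $T^x_{t,s}[W,\bar\mu_\cdot]u_s=u(t)$ where $u$ is the solution with $u(s)=u_s$. It is a bijection with inverse $T^x_{s,t}[W,\bar\mu_\cdot]$. The measure $\mu_0^x\circ T_{0,t}^x$ is $A\mapsto\mu_0^x(T_{0,t}^xA)$, i.e. the pushforward of $\mu_0^x$ under $T_{t,0}^x$. *)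

theory Defs
  imports "HOL-Probability.Probability" "HOL-Library.Real_Mod"
begin

section \<open>The circle\<close>

quotient_type circle = real / "\<lambda>x y. [x = y] (rmod (2 * pi))"
  by (auto intro!: equivpI reflpI sympI transpI simp: rcong_def)

lift_definition angle :: "circle \<Rightarrow> real" is "\<lambda>x. x rmod (2 * pi)"
  by (simp add: rcong_def)

lemma angle_bounds: "0 \<le> angle u" "angle u < 2 * pi"
  by (transfer, simp add: rmod_nonneg rmod_less)+

lemma angle_eq_iff: "angle u = angle v \<longleftrightarrow> u = v"
  by transfer (simp add: rcong_def)

lemma angle_abs_circle: "0 \<le> x \<Longrightarrow> x < 2 * pi \<Longrightarrow> angle (abs_circle x) = x"
  by (simp add: angle.abs_eq)

instantiation circle :: ab_group_add
begin

lift_definition zero_circle :: circle is 0 .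

lift_definition plus_circle :: "circle \<Rightarrow> circle \<Rightarrow> circle" is "(+)"
  by (rule rcong_add)

lift_definition minus_circle :: "circle \<Rightarrow> circle \<Rightarrow> circle" is "(-)"
  by (rule rcong_diff)

lift_definition uminus_circle :: "circle \<Rightarrow> circle" is uminus
  by (rule rcong_uminus)

instance
  by standard (transfer, simp add: rcong_def algebra_simps)+

end

instantiation circle :: metric_space
begin

definition dist_circle :: "circle \<Rightarrow> circle \<Rightarrow> real"
  where "dist_circle u v = min \<bar>angle u - angle v\<bar> (2 * pi - \<bar>angle u - angle v\<bar>)"

definition uniformity_circle :: "(circle \<times> circle) filter"
  where "uniformity_circle = (INF e\<in>{0<..}. principal {(x, y). dist x y < e})"

definition open_circle :: "circle set \<Rightarrow> bool"
  where "open_circle U \<longleftrightarrow> (\<forall>x\<in>U. \<forall>\<^sub>F (x', y) in uniformity. x' = x \<longrightarrow> y \<in> U)"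

instance
proof
  fix u v w :: circle
  show "dist u v = 0 \<longleftrightarrow> u = v"
    using angle_bounds[of u] angle_bounds[of v]
    unfolding dist_circle_def angle_eq_iff[symmetric] by (auto simp: min_def)
  show "dist u v \<le> dist u w + dist v w"
    using angle_bounds[of u] angle_bounds[of v] angle_bounds[of w]
    unfolding dist_circle_def by (auto simp: min_def)
qed (auto simp: uniformity_circle_def open_circle_def)

end

lemma dist_circle_le_angle: "dist u v \<le> \<bar>angle u - angle v\<bar>" for u v :: circle
  by (simp add: dist_circle_def)

lemma dist_circle_le_pi: "dist u v \<le> pi" for u v :: circle
  unfolding dist_circle_def by linarith

lemma circle_finite_net:
  assumes "e > 0"
  obtains p :: "nat \<Rightarrow> circle" and n where "\<And>u. \<exists>i<n. dist u (p i) < e"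
proof -
  define n where "n = nat \<lceil>2 * pi / e\<rceil> + 1"
  define p where "p i = abs_circle (real i * e)" for i
  have "\<exists>i<n. dist u (p i) < e" for u
  proof -
    define i where "i = nat \<lfloor>angle u / e\<rfloor>"
    have ge: "angle u / e \<ge> 0" using angle_bounds[of u] assms by simp
    have ri: "real i = of_int \<lfloor>angle u / e\<rfloor>" unfolding i_def using ge by simp
    have 1: "real i \<le> angle u / e" "angle u / e < real i + 1"
      unfolding ri by linarith+
    have 2: "real i * e \<le> angle u" "angle u < real i * e + e"
      using 1 assms by (simp_all add: field_simps)
    have "angle u / e < 2 * pi / e"
      using angle_bounds[of u] assms by (simp add: divide_strict_right_mono)
    then have "real i < 2 * pi / e" using 1 by linarith
    then have "i < n" unfolding n_def by linarith
    moreover have "angle (p i) = real i * e"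
      unfolding p_def using 2 angle_bounds[of u] assms by (intro angle_abs_circle) auto
    then have "dist u (p i) < e"
      using dist_circle_le_angle[of u "p i"] 2 by linarith
    ultimately show ?thesis by blast
  qed
  with that show ?thesis by blast
qed

section \<open>Borel probability measures on the circle\<close>

typedef circle_prob = "{\<mu> :: circle measure. prob_space \<mu> \<and> sets \<mu> = sets borel}"
  morphisms meas Abs_circle_prob
proof -
  have "prob_space (return borel (0 :: circle))" by (intro prob_space_return) simp
  then show ?thesis by (intro exI[of _ "return borel 0"]) auto
qed

lemma prob_space_meas: "prob_space (meas \<mu>)"
  and sets_meas [simp, measurable_cong]: "sets (meas \<mu>) = sets borel"
  using meas[of \<mu>] by auto

lemma space_meas [simp]: "space (meas \<mu>) = UNIV"
  using sets_eq_imp_space_eq[OF sets_meas] by simp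

lemma lipschitz_circle_meas:
  fixes f :: "circle \<Rightarrow> real"
  assumes "L-lipschitz_on UNIV f"
  shows "f \<in> borel_measurable borel" "integrable (meas \<mu>) f"
proof -
  interpret prob_space "meas \<mu>" by (rule prob_space_meas)
  show *: "f \<in> borel_measurable borel"
    by (intro borel_measurable_continuous_onI lipschitz_on_continuous_on[OF assms])
  have "\<bar>f u\<bar> \<le> \<bar>f 0\<bar> + L * pi" for u
  proof -
    have "dist (f u) (f 0) \<le> L * dist u 0" using lipschitz_onD[OF assms] by simp
    also have "\<dots> \<le> L * pi"
      using dist_circle_le_pi lipschitz_on_nonneg[OF assms] by (intro mult_left_mono) auto
    finally show ?thesis by (simp add: dist_real_def)
  qed
  then show "integrable (meas \<mu>) f" using *
    by (intro integrable_const_bound[where B = "\<bar>f 0\<bar> + L * pi"]) auto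
qed

lemma lipschitz_integral_diff_le:
  fixes p :: "nat \<Rightarrow> circle" and n :: nat and e :: real
  assumes net: "\<And>u. \<exists>i<n. dist u (p i) < e"
  defines "k \<equiv> \<lambda>u. LEAST i. dist u (p i) < e"
  assumes f: "1-lipschitz_on UNIV (f :: circle \<Rightarrow> real)"
  shows "\<bar>(LINT u|meas \<mu>. f u) - (LINT u|meas \<eta>. f u)\<bar>
    \<le> 2 * e + pi * (\<Sum>i<n. \<bar>measure (meas \<mu>) {u. k u = i} - measure (meas \<eta>) {u. k u = i}\<bar>)"
proof -
  define g where "g u = f u - f 0" for u
  define a where "a \<mu> i = measure (meas \<mu>) {u. k u = i}" for \<mu> i
  have g: "1-lipschitz_on UNIV g"
    using f by (auto simp: lipschitz_on_def g_def dist_real_def)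
  have k: "dist u (p (k u)) < e" "k u < n" for u
  proof -
    obtain i where i: "i < n" "dist u (p i) < e" using net by blast
    show "dist u (p (k u)) < e" unfolding k_def by (rule LeastI[of _ i]) (rule i)
    have "k u \<le> i" unfolding k_def by (rule Least_le) (rule i)
    with i show "k u < n" by simp
  qed
  have [measurable]: "(\<lambda>u. dist u (p i)) \<in> borel_measurable borel" for i
    by (intro borel_measurable_continuous_onI continuous_intros)
  have [measurable]: "k \<in> borel \<rightarrow>\<^sub>M count_space UNIV"
    unfolding k_def by measurable
  have [measurable]: "{u. k u = i} \<in> sets borel" for i by measurable
  have gb: "\<bar>g u\<bar> \<le> pi" for u
  proof -
    have "dist (g u) (g 0) \<le> 1 * dist u 0" using lipschitz_onD[OF g] by simp
    then show ?thesis using dist_circle_le_pi[of u 0] by (simp add: g_def dist_real_def)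
  qed
  have step: "\<bar>(LINT u|meas \<mu>. f u) - f 0 - (\<Sum>i<n. g (p i) * a \<mu> i)\<bar> \<le> e" for \<mu>
  proof -
    interpret prob_space "meas \<mu>" by (rule prob_space_meas)
    have eq: "g (p (k u)) = (\<Sum>i<n. g (p i) * indicator {u. k u = i} u)" for u
      using k(2)[of u] by (simp add: indicator_def sum.delta if_distrib cong: if_cong)
    have int: "integrable (meas \<mu>) (\<lambda>u. g (p (k u)))"
      unfolding eq by (intro Bochner_Integration.integrable_sum integrable_mult_right)
        (simp_all add: integrable_indicator_iff emeasure_eq_measure)
    have val: "(LINT u|meas \<mu>. g (p (k u))) = (\<Sum>i<n. g (p i) * a \<mu> i)"
      unfolding eq a_def
      by (subst Bochner_Integration.integral_sum)
        (simp_all add: integrable_indicator_iff emeasure_eq_measure)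
    have "(LINT u|meas \<mu>. g u) = (LINT u|meas \<mu>. f u) - f 0"
      unfolding g_def using lipschitz_circle_meas(2)[OF f, of \<mu>] prob_space
      by (subst Bochner_Integration.integral_diff) auto
    then have "(LINT u|meas \<mu>. f u) - f 0 - (\<Sum>i<n. g (p i) * a \<mu> i)
      = (LINT u|meas \<mu>. g u - g (p (k u)))"
      using lipschitz_circle_meas(2)[OF g, of \<mu>] int val by simp
    also have "\<bar>\<dots>\<bar> \<le> (LINT u|meas \<mu>. e)"
    proof (rule integral_abs_bound[THEN order_trans], rule integral_mono)
      show "integrable (meas \<mu>) (\<lambda>u. \<bar>g u - g (p (k u))\<bar>)"
        using lipschitz_circle_meas(2)[OF g, of \<mu>] int by simp
      show "\<bar>g u - g (p (k u))\<bar> \<le> e" for u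
        using lipschitz_onD[OF g, of u "p (k u)"] k(1)[of u] by (simp add: dist_real_def)
    qed simp
    also have "\<dots> = e" using prob_space by simp
    finally show ?thesis .
  qed
  have "\<bar>(\<Sum>i<n. g (p i) * a \<mu> i) - (\<Sum>i<n. g (p i) * a \<eta> i)\<bar>
      = \<bar>\<Sum>i<n. g (p i) * (a \<mu> i - a \<eta> i)\<bar>"
    by (simp add: sum_subtractf algebra_simps)
  also have "\<dots> \<le> (\<Sum>i<n. pi * \<bar>a \<mu> i - a \<eta> i\<bar>)"
    by (intro sum_abs[THEN order_trans] sum_mono) (simp add: abs_mult mult_right_mono gb)
  also have "\<dots> = pi * (\<Sum>i<n. \<bar>a \<mu> i - a \<eta> i\<bar>)" by (simp add: sum_distrib_left)
  finally show ?thesis using step[of \<mu>] step[of \<eta>] unfolding a_def by linarith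
qed

lemma lipschitz_integral_diff_bounded:
  assumes f: "1-lipschitz_on UNIV (f :: circle \<Rightarrow> real)"
  shows "\<bar>(LINT u|meas \<mu>. f u) - (LINT u|meas \<eta>. f u)\<bar> \<le> 2 * pi"
proof -
  have 1: "\<bar>(LINT u|meas \<mu>. f u) - f 0\<bar> \<le> pi" for \<mu>
  proof -
    interpret prob_space "meas \<mu>" by (rule prob_space_meas)
    have int: "integrable (meas \<mu>) (\<lambda>u. f u - f 0)"
      using lipschitz_circle_meas(2)[OF f] by simp
    have "(LINT u|meas \<mu>. f u) - f 0 = (LINT u|meas \<mu>. f u - f 0)"
      using lipschitz_circle_meas(2)[OF f, of \<mu>] prob_space by simp
    also have "\<bar>\<dots>\<bar> \<le> (LINT u|meas \<mu>. pi)"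
    proof (rule integral_abs_bound[THEN order_trans], rule integral_mono)
      show "\<bar>f u - f 0\<bar> \<le> pi" for u
        using lipschitz_onD[OF f, of u 0] dist_circle_le_pi[of u 0] by (simp add: dist_real_def)
    qed (use int in simp_all)
    also have "\<dots> = pi" using prob_space by simp
    finally show ?thesis .
  qed
  show ?thesis using 1[of \<mu>] 1[of \<eta>] by linarith
qed

lemma meas_eqI:
  assumes eq: "\<And>f :: circle \<Rightarrow> real. 1-lipschitz_on UNIV f \<Longrightarrow>
    (LINT u|meas \<mu>. f u) = (LINT u|meas \<eta>. f u)"
  shows "\<mu> = \<eta>"
proof -
  have cl: "measure (meas \<mu>) C = measure (meas \<eta>) C" if C: "closed C" "C \<noteq> {}" for C
  proof -
    define h where "h n u = max 0 (1 - real (Suc n) * infdist u C)" for n :: nat and u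
    have lip: "1-lipschitz_on UNIV (\<lambda>u. h n u / real (Suc n))" for n
    proof (intro lipschitz_onI)
      fix u v
      have *: "h n w / real (Suc n) = max 0 (1 / real (Suc n) - infdist w C)" for w
      proof -
        have "max 0 (1 - real (Suc n) * infdist w C) / real (Suc n)
            = max (0 / real (Suc n)) ((1 - real (Suc n) * infdist w C) / real (Suc n))"
          by (rule max_divide_distrib_right[THEN trans]) simp
        then show ?thesis unfolding h_def by (simp add: diff_divide_distrib del: of_nat_Suc)
      qed
      show "dist (h n u / real (Suc n)) (h n v / real (Suc n)) \<le> 1 * dist u v"
        unfolding * dist_real_def using infdist_triangle_abs[of u C v] by linarith
    qed simp
    have heq: "(LINT u|meas \<mu>. h n u) = (LINT u|meas \<eta>. h n u)" for n
      using eq[OF lip[of n]] by simp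
    have hm: "h n \<in> borel_measurable borel" for n
      unfolding h_def
      by (intro borel_measurable_continuous_onI continuous_intros)
    have lim: "(\<lambda>n. h n u) \<longlonglongrightarrow> indicator C u" for u
    proof (cases "u \<in> C")
      case True
      then show ?thesis by (simp add: h_def)
    next
      case False
      then have pos: "infdist u C > 0" using infdist_pos_not_in_closed[OF C] by simp
      obtain N :: nat where N: "1 / infdist u C < real N" using reals_Archimedean2 by blast
      have "h n u = 0" if "n \<ge> N" for n
      proof -
        have "1 / infdist u C < real (Suc n)" using N that by simp
        then show ?thesis using pos by (simp add: h_def field_simps)
      qed
      then have "eventually (\<lambda>n. h n u = 0) sequentially"
        by (auto simp: eventually_sequentially)
      then show ?thesis using False by (simp add: tendsto_eventually)
    qed
    have conv: "(\<lambda>n. LINT u|meas \<nu>. h n u) \<longlonglongrightarrow> measure (meas \<nu>) C" for \<nu>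
    proof -
      interpret prob_space "meas \<nu>" by (rule prob_space_meas)
      have [measurable]: "C \<in> sets borel" using C by simp
      have "(\<lambda>n. LINT u|meas \<nu>. h n u) \<longlonglongrightarrow> (LINT u|meas \<nu>. indicator C u)"
      proof (rule integral_dominated_convergence[where w = "\<lambda>_. 1"])
        show "AE u in meas \<nu>. norm (h n u) \<le> 1" for n
          using infdist_nonneg[of _ C] by (auto simp: h_def)
      qed (use hm lim in auto)
      then show ?thesis by simp
    qed
    show ?thesis
      using LIMSEQ_unique[OF conv[of \<mu>]] conv[of \<eta>] heq by auto
  qed
  have "meas \<mu> = meas \<eta>"
  proof (rule measure_eqI_generator_eq[where E = "Collect closed" and A = "\<lambda>_. UNIV" and \<Omega> = UNIV])
    interpret \<mu>: prob_space "meas \<mu>" by (rule prob_space_meas)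
    interpret \<eta>: prob_space "meas \<eta>" by (rule prob_space_meas)
    show "Int_stable (Collect closed)" by (auto simp: Int_stable_def)
    show "emeasure (meas \<mu>) C = emeasure (meas \<eta>) C" if "C \<in> Collect closed" for C
      using cl[of C] that by (cases "C = {}") (auto simp: \<mu>.emeasure_eq_measure \<eta>.emeasure_eq_measure)
    show "sets (meas \<mu>) = sigma_sets UNIV (Collect closed)"
      "sets (meas \<eta>) = sigma_sets UNIV (Collect closed)"
      by (simp_all add: borel_eq_closed)
  qed (auto simp: prob_space.emeasure_space_1[OF prob_space_meas, simplified])
  then show ?thesis by (simp add: meas_inject)
qed

instantiation circle_prob :: metric_space
begin

definition dist_circle_prob :: "circle_prob \<Rightarrow> circle_prob \<Rightarrow> real"
  where "dist_circle_prob \<mu> \<eta> =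
    (SUP f\<in>{f :: circle \<Rightarrow> real. 1-lipschitz_on UNIV f}.
      \<bar>(LINT u|meas \<mu>. f u) - (LINT u|meas \<eta>. f u)\<bar>)"

definition uniformity_circle_prob :: "(circle_prob \<times> circle_prob) filter"
  where "uniformity_circle_prob = (INF e\<in>{0<..}. principal {(x, y). dist x y < e})"

definition open_circle_prob :: "circle_prob set \<Rightarrow> bool"
  where "open_circle_prob U \<longleftrightarrow> (\<forall>x\<in>U. \<forall>\<^sub>F (x', y) in uniformity. x' = x \<longrightarrow> y \<in> U)"

lemma lipschitz_integral_diff_le_dist:
  assumes "1-lipschitz_on UNIV (f :: circle \<Rightarrow> real)"
  shows "\<bar>(LINT u|meas \<mu>. f u) - (LINT u|meas \<eta>. f u)\<bar> \<le> dist \<mu> \<eta>"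
  unfolding dist_circle_prob_def
  by (rule cSUP_upper) (use assms lipschitz_integral_diff_bounded in \<open>auto intro!: bdd_aboveI2\<close>)

lemma dist_circle_prob_leI:
  assumes "\<And>f :: circle \<Rightarrow> real. 1-lipschitz_on UNIV f \<Longrightarrow>
    \<bar>(LINT u|meas \<mu>. f u) - (LINT u|meas \<eta>. f u)\<bar> \<le> b"
  shows "dist \<mu> \<eta> \<le> b"
proof -
  have "1-lipschitz_on UNIV (\<lambda>u :: circle. 0 :: real)" by (simp add: lipschitz_on_def)
  then show ?thesis
    unfolding dist_circle_prob_def by (intro cSUP_least) (use assms in auto)
qed

instance
proof
  fix \<mu> \<eta> \<nu> :: circle_prob
  have "1-lipschitz_on UNIV (\<lambda>u :: circle. 0 :: real)" by (simp add: lipschitz_on_def)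
  note nonneg = lipschitz_integral_diff_le_dist[OF this]
  show "dist \<mu> \<eta> = 0 \<longleftrightarrow> \<mu> = \<eta>"
  proof
    assume 0: "dist \<mu> \<eta> = 0"
    show "\<mu> = \<eta>" by (rule meas_eqI) (use lipschitz_integral_diff_le_dist[of _ \<mu> \<eta>] 0 in fastforce)
  next
    assume "\<mu> = \<eta>"
    then have "dist \<mu> \<eta> \<le> 0" by (intro dist_circle_prob_leI) simp
    with nonneg[of \<mu> \<eta>] show "dist \<mu> \<eta> = 0" by simp
  qed
  show "dist \<mu> \<eta> \<le> dist \<mu> \<nu> + dist \<eta> \<nu>"
  proof (rule dist_circle_prob_leI)
    fix f :: "circle \<Rightarrow> real" assume "1-lipschitz_on UNIV f"
    from lipschitz_integral_diff_le_dist[OF this, of \<mu> \<nu>]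
      lipschitz_integral_diff_le_dist[OF this, of \<eta> \<nu>]
    show "\<bar>(LINT u|meas \<mu>. f u) - (LINT u|meas \<eta>. f u)\<bar> \<le> dist \<mu> \<nu> + dist \<eta> \<nu>" by linarith
  qed
qed (auto simp: uniformity_circle_prob_def open_circle_prob_def)

end

lemma dist_circle_prob_le: "dist \<mu> \<eta> \<le> 2 * pi" for \<mu> \<eta> :: circle_prob
  by (rule dist_circle_prob_leI) (rule lipschitz_integral_diff_bounded)

lemma circle_prob_countable_cover:
  assumes "e > 0"
  obtains C :: "circle_prob set" where "countable C" "\<And>\<mu>. \<exists>\<nu>\<in>C. dist \<mu> \<nu> < e"
proof -
  have pos: "e / 8 > 0" using assms by simp
  obtain p :: "nat \<Rightarrow> circle" and n where net: "\<And>u. \<exists>i<n. dist u (p i) < e / 8"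
    by (rule circle_finite_net[OF pos]) (rule that)
  define k where "k u = (LEAST i. dist u (p i) < e / 8)" for u
  define N where "N = 4 * pi * (real n + 1) / e"
  have N: "N > 0" unfolding N_def using assms by simp
  define a where "a \<mu> = map (\<lambda>i. \<lfloor>N * measure (meas \<mu>) {u. k u = i}\<rfloor>) [0..<n]" for \<mu>
  define C where "C = (\<lambda>l. SOME \<nu>. a \<nu> = l) ` UNIV"
  have "\<exists>\<nu>\<in>C. dist \<mu> \<nu> < e" for \<mu>
  proof
    define \<nu> where "\<nu> = (SOME \<nu>. a \<nu> = a \<mu>)"
    have a: "a \<nu> = a \<mu>" unfolding \<nu>_def by (rule someI[of _ \<mu>]) simp
    show "\<nu> \<in> C" unfolding \<nu>_def C_def by blast
    have close: "\<bar>measure (meas \<mu>) {u. k u = i} - measure (meas \<nu>) {u. k u = i}\<bar> \<le> 1 / N"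
      if "i < n" for i
    proof -
      have "\<lfloor>N * measure (meas \<mu>) {u. k u = i}\<rfloor> = \<lfloor>N * measure (meas \<nu>) {u. k u = i}\<rfloor>"
        using a that by (auto simp: a_def)
      then have "\<bar>N * measure (meas \<mu>) {u. k u = i} - N * measure (meas \<nu>) {u. k u = i}\<bar> \<le> 1"
        by linarith
      also have "N * measure (meas \<mu>) {u. k u = i} - N * measure (meas \<nu>) {u. k u = i}
        = N * (measure (meas \<mu>) {u. k u = i} - measure (meas \<nu>) {u. k u = i})"
        by (simp add: algebra_simps)
      finally show ?thesis using N by (simp add: abs_mult pos_le_divide_eq mult.commute)
    qed
    have "dist \<mu> \<nu> \<le> 2 * (e / 8) + pi * (real n * (1 / N))"
    proof (rule dist_circle_prob_leI)
      fix f :: "circle \<Rightarrow> real" assume f: "1-lipschitz_on UNIV f"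
      have "\<bar>(LINT u|meas \<mu>. f u) - (LINT u|meas \<nu>. f u)\<bar> \<le> 2 * (e / 8) + pi *
        (\<Sum>i<n. \<bar>measure (meas \<mu>) {u. k u = i} - measure (meas \<nu>) {u. k u = i}\<bar>)"
        unfolding k_def by (rule lipschitz_integral_diff_le[OF net f])
      moreover have "(\<Sum>i<n. \<bar>measure (meas \<mu>) {u. k u = i} - measure (meas \<nu>) {u. k u = i}\<bar>)
          \<le> real n * (1 / N)"
        using sum_bounded_above[of "{..<n}", OF close] by simp
      ultimately show "\<bar>(LINT u|meas \<mu>. f u) - (LINT u|meas \<nu>. f u)\<bar>
          \<le> 2 * (e / 8) + pi * (real n * (1 / N))"
        by (smt (verit) mult_left_mono pi_ge_zero)
    qed
    also have "pi * (real n * (1 / N)) \<le> e / 4"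
    proof -
      have N': "N * e = 4 * pi * (real n + 1)" unfolding N_def using assms by simp
      have "4 * pi * real n \<le> N * e" unfolding N' by simp
      then show ?thesis using N by (simp add: pos_divide_le_eq) (simp add: algebra_simps)
    qed
    finally show "dist \<mu> \<nu> < e" using assms by linarith
  qed
  moreover have "countable C" unfolding C_def by blast
  ultimately show ?thesis using that by blast
qed

lemma borel_measurable_dist_circle_prob:
  fixes f g :: "'a \<Rightarrow> circle_prob"
  assumes f: "f \<in> borel_measurable M" and g: "g \<in> borel_measurable M"
  shows "(\<lambda>x. dist (f x) (g x)) \<in> borel_measurable M"
proof -
  have "\<forall>n :: nat. \<exists>C :: circle_prob set. countable C \<and> (\<forall>\<mu>. \<exists>\<nu>\<in>C. dist \<mu> \<nu> < 1 / real (Suc n))"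
    using circle_prob_countable_cover[of "1 / real (Suc _)"]
    by (metis of_nat_0_less_iff zero_less_Suc zero_less_divide_1_iff)
  then obtain C :: "nat \<Rightarrow> circle_prob set" where C: "\<And>n. countable (C n)"
    "\<And>n \<mu>. \<exists>\<nu>\<in>C n. dist \<mu> \<nu> < 1 / real (Suc n)" by metis
  define D where "D = (\<Union>n. C n)"
  have D: "countable D" unfolding D_def using C by simp
  have D2: "\<exists>\<nu>\<in>D. dist \<mu> \<nu> < e" if e: "e > 0" for \<mu> e
  proof -
    obtain n where n: "1 / real (Suc n) < e" using nat_approx_posE[OF e] by blast
    show ?thesis using C(2)[of n \<mu>] n unfolding D_def by force
  qed
  have ne: "D \<noteq> {}" using D2[of 1] by auto
  have eq: "dist (f x) (g x) = (INF \<nu>\<in>D. dist (f x) \<nu> + dist (g x) \<nu>)" for x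
  proof (rule antisym)
    show "dist (f x) (g x) \<le> (INF \<nu>\<in>D. dist (f x) \<nu> + dist (g x) \<nu>)"
      by (rule cINF_greatest[OF ne]) (rule dist_triangle2)
    show "(INF \<nu>\<in>D. dist (f x) \<nu> + dist (g x) \<nu>) \<le> dist (f x) (g x)"
    proof (rule field_le_epsilon)
      fix e :: real assume "e > 0"
      then obtain \<nu> where \<nu>: "\<nu> \<in> D" "dist (f x) \<nu> < e / 2" using D2[of "e / 2" "f x"] by auto
      have "(INF \<nu>\<in>D. dist (f x) \<nu> + dist (g x) \<nu>) \<le> dist (f x) \<nu> + dist (g x) \<nu>"
        by (rule cINF_lower[OF _ \<nu>(1)]) (auto intro!: bdd_belowI2[where m = 0])
      also have "\<dots> \<le> dist (f x) (g x) + e"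
        using \<nu>(2) dist_triangle[of "g x" \<nu> "f x"] by (simp add: dist_commute)
      finally show "(INF \<nu>\<in>D. dist (f x) \<nu> + dist (g x) \<nu>) \<le> dist (f x) (g x) + e" .
    qed
  qed
  have meas: "(\<lambda>x. dist (h x) \<nu>) \<in> borel_measurable M"
    if "h \<in> borel_measurable M" for h and \<nu> :: circle_prob
  proof -
    have "(\<lambda>\<mu>. dist \<mu> \<nu>) \<in> borel_measurable borel"
      by (intro borel_measurable_continuous_onI continuous_intros)
    from measurable_compose[OF that this] show ?thesis .
  qed
  show ?thesis unfolding eq
    by (intro borel_measurable_cINF_real D borel_measurable_add meas f g)
qed

section \<open>Measurable families of probability measures\<close>

text \<open>Classes of measurable functions from the unit interval to the probability measures, modulo
  equality almost everywhere. The values of a representative outside the unit interval are irrelevant.\<close>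

abbreviation I_leb :: "real measure"
  where "I_leb \<equiv> lebesgue_on {0..1}"

lemma prob_space_I_leb: "prob_space I_leb"
  by (rule prob_spaceI) (simp add: emeasure_restrict_space)

quotient_type prob_family = "real \<Rightarrow> circle_prob" / partial:
  "\<lambda>f g. f \<in> borel_measurable I_leb \<and> g \<in> borel_measurable I_leb \<and> (AE x in I_leb. f x = g x)"
proof (rule part_equivpI)
  show "\<exists>f :: real \<Rightarrow> circle_prob. f \<in> borel_measurable I_leb \<and> f \<in> borel_measurable I_leb \<and>
    (AE x in I_leb. f x = f x)"
    by (intro exI[of _ "\<lambda>_. undefined"]) simp
qed (auto intro!: sympI transpI)

definition is_version :: "(real \<Rightarrow> circle_prob) \<Rightarrow> prob_family \<Rightarrow> bool"
  where "is_version m \<mu> \<longleftrightarrow> m \<in> borel_measurable I_leb \<and> abs_prob_family m = \<mu>"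

lemma integrable_dist_circle_prob:
  assumes "f \<in> borel_measurable I_leb" "g \<in> borel_measurable I_leb"
  shows "integrable I_leb (\<lambda>x. dist (f x) (g x :: circle_prob))"
proof -
  interpret prob_space I_leb by (rule prob_space_I_leb)
  show ?thesis
    by (intro integrable_const_bound[where B = "2 * pi"] borel_measurable_dist_circle_prob assms)
      (simp add: dist_circle_prob_le)
qed

instantiation prob_family :: metric_space
begin

lift_definition dist_prob_family :: "prob_family \<Rightarrow> prob_family \<Rightarrow> real"
  is "\<lambda>f g. LINT x|I_leb. dist (f x) (g x)"
  by (rule integral_cong_AE) (auto intro: borel_measurable_dist_circle_prob)

definition uniformity_prob_family :: "(prob_family \<times> prob_family) filter"
  where "uniformity_prob_family = (INF e\<in>{0<..}. principal {(x, y). dist x y < e})"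

definition open_prob_family :: "prob_family set \<Rightarrow> bool"
  where "open_prob_family U \<longleftrightarrow> (\<forall>x\<in>U. \<forall>\<^sub>F (x', y) in uniformity. x' = x \<longrightarrow> y \<in> U)"

instance
proof
  fix a b c :: prob_family
  show "dist a b = 0 \<longleftrightarrow> a = b"
  proof transfer
    fix f g :: "real \<Rightarrow> circle_prob"
    assume "f \<in> borel_measurable I_leb \<and> f \<in> borel_measurable I_leb \<and> (AE x in I_leb. f x = f x)"
      and "g \<in> borel_measurable I_leb \<and> g \<in> borel_measurable I_leb \<and> (AE x in I_leb. g x = g x)"
    then show "(LINT x|I_leb. dist (f x) (g x)) = 0 \<longleftrightarrow>
      f \<in> borel_measurable I_leb \<and> g \<in> borel_measurable I_leb \<and> (AE x in I_leb. f x = g x)"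
      by (subst integral_nonneg_eq_0_iff_AE) (auto intro: integrable_dist_circle_prob)
  qed
  show "dist a b \<le> dist a c + dist b c"
  proof transfer
    fix f g h :: "real \<Rightarrow> circle_prob"
    assume "f \<in> borel_measurable I_leb \<and> f \<in> borel_measurable I_leb \<and> (AE x in I_leb. f x = f x)"
      and "g \<in> borel_measurable I_leb \<and> g \<in> borel_measurable I_leb \<and> (AE x in I_leb. g x = g x)"
      and "h \<in> borel_measurable I_leb \<and> h \<in> borel_measurable I_leb \<and> (AE x in I_leb. h x = h x)"
    then have int: "integrable I_leb (\<lambda>x. dist (f x) (g x))" "integrable I_leb (\<lambda>x. dist (f x) (h x))"
      "integrable I_leb (\<lambda>x. dist (g x) (h x))"
      by (auto intro: integrable_dist_circle_prob)
    then have "(LINT x|I_leb. dist (f x) (g x)) \<le> (LINT x|I_leb. dist (f x) (h x) + dist (g x) (h x))"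
      by (intro integral_mono) (auto intro: dist_triangle2)
    then show "(LINT x|I_leb. dist (f x) (g x))
        \<le> (LINT x|I_leb. dist (f x) (h x)) + (LINT x|I_leb. dist (g x) (h x))"
      using int by simp
  qed
qed (auto simp: uniformity_prob_family_def open_prob_family_def)

end

text \<open>Continuous curves on the time interval; extensionality makes two curves equal as soon as they
  agree on that interval.\<close>

definition curves :: "real \<Rightarrow> (real \<Rightarrow> prob_family) set"
  where "curves T = {\<mu> \<in> extensional {0..T}. continuous_on {0..T} \<mu>}"

section \<open>The velocity field, its flow and the fixed point equation\<close>

lemma integral_I_leb_cong_AE:
  fixes f g :: "real \<Rightarrow> real"
  assumes "AE x in I_leb. f x = g x"
  shows "(LINT x|I_leb. f x) = (LINT x|I_leb. g x)"
proof -
  define F where "F x = indicator {0..1} x *\<^sub>R f x" for x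
  define G where "G x = indicator {0..1} x *\<^sub>R g x" for x
  have int: "(LINT x|I_leb. f x) = (LINT x|lebesgue. F x)" "(LINT x|I_leb. g x) = (LINT x|lebesgue. G x)"
    unfolding F_def G_def by (simp_all add: integral_restrict_space)
  have "AE x in lebesgue. x \<in> {0..1} \<longrightarrow> f x = g x"
    using assms by (simp add: AE_restrict_space_iff)
  then have ae: "AE x in lebesgue. F x = G x"
    by eventually_elim (auto simp: F_def G_def indicator_def)
  then have ae': "AE x in lebesgue. G x = F x" by eventually_elim simp
  show ?thesis
  proof (cases "F \<in> borel_measurable lebesgue")
    case True
    then have "G \<in> borel_measurable lebesgue" using borel_measurable_AE ae by blast
    with True ae show ?thesis unfolding int by (intro integral_cong_AE)
  next
    case False
    then have "G \<notin> borel_measurable lebesgue" using borel_measurable_AE ae' by blast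
    with False have "\<not> integrable lebesgue F" "\<not> integrable lebesgue G"
      by (auto dest: borel_measurable_integrable)
    then show ?thesis unfolding int by (simp add: not_integrable_integral_eq)
  qed
qed

lift_definition velocity ::
  "(real \<Rightarrow> real \<Rightarrow> real) \<Rightarrow> (circle \<Rightarrow> real) \<Rightarrow> prob_family \<Rightarrow> circle \<Rightarrow> real \<Rightarrow> real"
  is "\<lambda>W D m u x. LINT y|I_leb. W x y * (LINT v|meas (m y). D (v - u))"
  by (intro ext integral_I_leb_cong_AE) auto

text \<open>A curve on the circle solves the equation when it has a differentiable real-valued lift whose
  derivative is the (real-valued) velocity; derivatives at the end points are one-sided.\<close>

definition circle_ode :: "(circle \<Rightarrow> real \<Rightarrow> real) \<Rightarrow> real \<Rightarrow> (real \<Rightarrow> circle) \<Rightarrow> bool"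
  where "circle_ode V T u \<longleftrightarrow> (\<exists>w. (\<forall>r\<in>{0..T}. u r = abs_circle (w r) \<and>
    (w has_real_derivative V (u r) r) (at r within {0..T})))"

definition flow :: "(circle \<Rightarrow> real \<Rightarrow> real) \<Rightarrow> real \<Rightarrow> real \<Rightarrow> real \<Rightarrow> circle \<Rightarrow> circle"
  where "flow V T t s u\<^sub>s = (THE p. \<exists>u. circle_ode V T u \<and> u s = u\<^sub>s \<and> u t = p)"

definition flowW :: "(real \<Rightarrow> real \<Rightarrow> real) \<Rightarrow> (circle \<Rightarrow> real) \<Rightarrow> real \<Rightarrow> (real \<Rightarrow> prob_family)
    \<Rightarrow> real \<Rightarrow> real \<Rightarrow> real \<Rightarrow> circle \<Rightarrow> circle"
  where "flowW W D T \<mu> x = flow (\<lambda>u t. velocity W D (\<mu> t) u x) T"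

text \<open>The measure \<open>A \<mapsto> \<mu>\<^sub>0\<^sup>x (T\<^sub>0\<^sub>,\<^sub>t A)\<close> is the image of \<open>\<mu>\<^sub>0\<^sup>x\<close> under the inverse
  of the flow from time t to time 0, which is the flow from time 0 to time t. The exceptional null
  set of labels x does not depend on t; as the members of a curve are classes modulo null sets, the
  equation has to be read for suitable representatives.\<close>

definition fixed_point_solution :: "(real \<Rightarrow> real \<Rightarrow> real) \<Rightarrow> (circle \<Rightarrow> real) \<Rightarrow> real \<Rightarrow> prob_family
    \<Rightarrow> (real \<Rightarrow> prob_family) \<Rightarrow> bool"
  where "fixed_point_solution W D T \<mu>\<^sub>0 \<mu> \<longleftrightarrow>
    (\<exists>m\<^sub>0 m. is_version m\<^sub>0 \<mu>\<^sub>0 \<and> (\<forall>t\<in>{0..T}. is_version (m t) (\<mu> t)) \<and>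
      (AE x in I_leb. \<forall>t\<in>{0..T}. meas (m t x) = distr (meas (m\<^sub>0 x)) borel (flowW W D T \<mu> x t 0)))"

end

theory Submission
  imports Defs
begin

text \<open>Given the initial family, a curve and its velocity field determine each other: a curve has the mean-field velocity
  \<open>V u x t = \<integral> W x y * (\<integral> D (v - u) d\<mu>\<^sub>t\<^sup>y v) dy\<close>, and a velocity field V moves the initial family
  to the curve \<open>\<mu>\<^sub>t\<^sup>x\<close>, the image of \<open>\<mu>\<^sub>0\<^sup>x\<close> under the flow of V at label x. Solving the fixed point
  equation means finding a field that is the velocity of the curve that it generates. The
  argument is carried out for fields rather than for curves of measures, because fields are
  real-valued functions, whose iterates converge pointwise to a field again
  (\<open>weighted_contraction_fixed_point\<close>).

  The map \<open>updated_field\<close>, which sends a field to the velocity of the transported curve, is a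
  contraction with factor one half in the norm \<open>sup exp (- 3 t) \<bar>V u x t\<bar>\<close>. Indeed, if two fields
  differ by at most \<open>K exp (3 t)\<close>, a Gronwall argument (\<open>lift_solution_compare\<close>, \<open>flow_compare\<close>)
  shows that their flows differ by at most \<open>K / 2 * exp (3 t)\<close>; the transported measures then differ by
  at most this in the Lipschitz-dual metric (\<open>dist_push_maps_le\<close>), and as D is 1-Lipschitz and
  W is bounded by 1, so do the new velocities (\<open>updated_field_contraction\<close>).
  Existence and uniqueness of a self-consistent field follow
  (\<open>self_consistent_field_exists\<close>, \<open>self_consistent_field_unique\<close>), and fields correspond to
  solutions (\<open>self_consistent_field_solves\<close>, \<open>solution_velocity_self_consistent\<close>).

  Measurability of the transported family in the label is the point where continuity of W in its
  first variable in \<open>L\<^sup>1\<close> is needed: it makes velocities, and by \<open>flow_compare\<close> also flows,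
  continuous in the label, so that the transported family arises from the measurable initial family
  through a function continuous in label and measure separately
  (\<open>caratheodory_measurable\<close>, \<open>transported_measurable\<close>).\<close>

section \<open>Lifting the circle to the real line\<close>

lemma abs_circle_angle: "abs_circle (angle p) = p"
  by (metis angle_eq_iff angle_abs_circle angle_bounds)

lemma abs_circle_eqE:
  assumes "abs_circle a = abs_circle b"
  obtains k :: int where "b = a + 2 * pi * of_int k"
proof -
  have "a rmod (2 * pi) = b rmod (2 * pi)"
    using assms by (simp add: circle.abs_eq_iff rcong_def)
  then have "b = a + 2 * pi * of_int (\<lfloor>b / (2 * pi)\<rfloor> - \<lfloor>a / (2 * pi)\<rfloor>)"
    by (simp add: rmod_def algebra_simps)
  then show ?thesis by (rule that)
qed

lemma abs_circle_shift: "abs_circle (a + 2 * pi * of_int k) = abs_circle a"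
proof -
  have "[2 * pi * of_int k = 0] (rmod (2 * pi))"
    using rmod_self_multiple_int'[of "2 * pi" k] by (simp add: rcong_def)
  then have "[a + 2 * pi * of_int k = a + 0] (rmod (2 * pi))"
    by (intro rcong_add) auto
  then show ?thesis by (simp add: circle.abs_eq_iff)
qed

text \<open>The integers \<open>\<lfloor>a / 2\<pi>\<rfloor>\<close> and \<open>\<lfloor>b / 2\<pi>\<rfloor>\<close> removed from two reals closer
  than \<open>\<pi>\<close> differ by at most one, and a difference of one is what the second branch of the
  minimum defining the distance accounts for.\<close>

lemma dist_abs_circle_le: "dist (abs_circle a) (abs_circle b) \<le> \<bar>a - b\<bar>"
proof (cases "\<bar>a - b\<bar> < pi")
  case False
  then show ?thesis using dist_circle_le_pi[of "abs_circle a" "abs_circle b"] by linarith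
next
  case True
  define k where "k = \<lfloor>a / (2 * pi)\<rfloor> - \<lfloor>b / (2 * pi)\<rfloor>"
  have ab: "angle (abs_circle a) - angle (abs_circle b) = a - b - 2 * pi * of_int k"
    by (simp add: angle.abs_eq rmod_def k_def algebra_simps)
  have "\<bar>a - b - 2 * pi * of_int k\<bar> < 2 * pi"
    unfolding ab[symmetric]
    using angle_bounds[of "abs_circle a"] angle_bounds[of "abs_circle b"] by linarith
  then have "\<bar>2 * pi * of_int k\<bar> < 2 * pi * 2" using True by linarith
  then have "\<bar>of_int k :: real\<bar> < 2" by (simp add: abs_mult)
  then have "k = -1 \<or> k = 0 \<or> k = 1" by linarith
  then show ?thesis using True unfolding dist_circle_def ab by auto
qed

text \<open>Passing to such lifts turns every estimate on the circle, in particular the Gronwall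
  estimate for the flow, into one on the real line.\<close>

lemma circle_lifts_at_distance:
  obtains a b where "p = abs_circle a" "q = abs_circle b" "\<bar>a - b\<bar> = dist p q"
proof -
  let ?a = "angle p" and ?b = "angle q"
  have bd: "0 \<le> ?a" "?a < 2 * pi" "0 \<le> ?b" "?b < 2 * pi" by (simp_all add: angle_bounds)
  consider "dist p q = \<bar>?a - ?b\<bar>" | "dist p q = 2 * pi - \<bar>?a - ?b\<bar>" "?a \<le> ?b"
    | "dist p q = 2 * pi - \<bar>?a - ?b\<bar>" "?b \<le> ?a"
    unfolding dist_circle_def by linarith
  then show ?thesis
  proof cases
    case 1
    then show ?thesis using that[of ?a ?b] by (simp add: abs_circle_angle)
  next
    case 2
    then show ?thesis using that[of "?a + 2 * pi * of_int 1" ?b] bd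
      unfolding abs_circle_shift by (simp add: abs_circle_angle)
  next
    case 3
    then show ?thesis using that[of ?a "?b + 2 * pi * of_int 1"] bd
      unfolding abs_circle_shift by (simp add: abs_circle_angle)
  qed
qed

lemma dist_circle_diff_left: "dist (r - p) (r - q) \<le> dist p q" for p q r :: circle
proof -
  obtain a b where ab: "p = abs_circle a" "q = abs_circle b" "\<bar>a - b\<bar> = dist p q"
    by (rule circle_lifts_at_distance)
  have "r - p = abs_circle (angle r - a)" "r - q = abs_circle (angle r - b)"
    unfolding ab minus_circle.abs_eq[symmetric] abs_circle_angle by simp_all
  then show ?thesis
    using dist_abs_circle_le[of "angle r - a" "angle r - b"] ab(3) by simp
qed

lemma dist_circle_diff_right: "dist (p - r) (q - r) \<le> dist p q" for p q r :: circle
proof -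
  obtain a b where ab: "p = abs_circle a" "q = abs_circle b" "\<bar>a - b\<bar> = dist p q"
    by (rule circle_lifts_at_distance)
  have "p - r = abs_circle (a - angle r)" "q - r = abs_circle (b - angle r)"
    unfolding ab minus_circle.abs_eq[symmetric] abs_circle_angle by simp_all
  then show ?thesis
    using dist_abs_circle_le[of "a - angle r" "b - angle r"] ab(3) by simp
qed

section \<open>Contractions in a weighted supremum norm\<close>

text \<open>The Banach fixed point theorem for real-valued functions compared through the norm
  \<open>sup\<^sub>z |f z| / \<rho> z\<close>. Completeness is replaced by closure of the class \<open>P\<close> under pointwise
  limits on \<open>S\<close>: the iterates are Cauchy at each point with a rate proportional to \<open>\<rho>\<close>, so their
  pointwise limit lies in \<open>P\<close> and is also the limit in the weighted norm. Functions are
  compared on \<open>S\<close> only, so the limit solves the equation on \<open>S\<close>.\<close>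

lemma weighted_contraction_fixed_point:
  fixes F :: "('a \<Rightarrow> real) \<Rightarrow> 'a \<Rightarrow> real" and \<rho> :: "'a \<Rightarrow> real"
  assumes closed: "\<And>f l. (\<And>n. f n \<in> P) \<Longrightarrow> (\<And>z. z \<in> S \<Longrightarrow> (\<lambda>n. f n z) \<longlonglongrightarrow> l z) \<Longrightarrow> l \<in> P"
    and maps: "\<And>f. f \<in> P \<Longrightarrow> F f \<in> P"
    and contr: "\<And>f g K z. f \<in> P \<Longrightarrow> g \<in> P \<Longrightarrow> (\<And>z. z \<in> S \<Longrightarrow> \<bar>f z - g z\<bar> \<le> K * \<rho> z) \<Longrightarrow>
      z \<in> S \<Longrightarrow> \<bar>F f z - F g z\<bar> \<le> K / 2 * \<rho> z"
    and start: "f0 \<in> P" "\<And>z. z \<in> S \<Longrightarrow> \<bar>F f0 z - f0 z\<bar> \<le> K0 * \<rho> z"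
  shows "\<exists>f\<in>P. \<forall>z\<in>S. F f z = f z"
proof -
  define f where "f n = (F ^^ n) f0" for n
  have fP: "f n \<in> P" for n
    by (induction n) (simp_all add: f_def start maps)
  have step: "\<bar>f (Suc n) z - f n z\<bar> \<le> K0 / 2 ^ n * \<rho> z" if "z \<in> S" for n z
    using that
  proof (induction n arbitrary: z)
    case 0
    then show ?case using start(2) by (simp add: f_def)
  next
    case (Suc n)
    from contr[OF fP fP Suc.IH Suc.prems] show ?case by (simp add: f_def field_simps)
  qed
  have tail: "\<bar>f (n + j) z - f n z\<bar> \<le> 2 * K0 * \<rho> z * (1 / 2 ^ n - 1 / 2 ^ (n + j))"
    if "z \<in> S" for n j z
  proof (induction j)
    case (Suc j)
    have "2 * K0 * \<rho> z * (1 / 2 ^ n - 1 / 2 ^ (n + j)) + K0 / 2 ^ (n + j) * \<rho> z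
      = 2 * K0 * \<rho> z * (1 / 2 ^ n - 1 / 2 ^ (n + Suc j))"
      by (simp add: field_simps)
    then show ?case using Suc step[OF that, of "n + j"] by simp
  qed simp
  have K0: "K0 * \<rho> z \<ge> 0" if "z \<in> S" for z using start(2)[OF that] by linarith
  have near: "\<bar>f m z - f n z\<bar> \<le> 2 * K0 * \<rho> z / 2 ^ n" if "z \<in> S" "n \<le> m" for m n z
  proof -
    have "2 * K0 * \<rho> z * (1 / 2 ^ n - 1 / 2 ^ m) \<le> 2 * K0 * \<rho> z * (1 / 2 ^ n)"
      using K0[OF that(1)] by (intro mult_left_mono) auto
    then show ?thesis using tail[OF that(1), of n "m - n"] that(2) by simp
  qed
  have van: "(\<lambda>n. c / 2 ^ n :: real) \<longlonglongrightarrow> 0" for c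
    using tendsto_mult_right_zero[OF LIMSEQ_power_zero[of "1 / 2 :: real"], of c]
    by (simp add: power_one_over field_simps)
  have conv: "convergent (\<lambda>n. f n z)" if z: "z \<in> S" for z
    unfolding Cauchy_convergent_iff[symmetric] Cauchy_altdef2 dist_real_def
  proof (intro allI impI)
    fix e :: real assume "e > 0"
    then have "eventually (\<lambda>n. 2 * K0 * \<rho> z / 2 ^ n < e) sequentially"
      by (rule order_tendstoD(2)[OF van])
    then obtain N where "2 * K0 * \<rho> z / 2 ^ N < e" by (auto simp: eventually_sequentially)
    then show "\<exists>N. \<forall>n\<ge>N. \<bar>f n z - f N z\<bar> < e"
      using le_less_trans[OF near[OF z]] by blast
  qed
  define l where "l z = lim (\<lambda>n. f n z)" for z
  have lim: "(\<lambda>n. f n z) \<longlonglongrightarrow> l z" if "z \<in> S" for z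
    using conv[OF that] by (simp add: l_def convergent_LIMSEQ_iff)
  have lP: "l \<in> P" by (rule closed[of f]) (use fP lim in auto)
  have lf: "\<bar>l z - f n z\<bar> \<le> 2 * K0 / 2 ^ n * \<rho> z" if z: "z \<in> S" for n z
  proof (rule LIMSEQ_le_const2)
    show "(\<lambda>m. \<bar>f m z - f n z\<bar>) \<longlonglongrightarrow> \<bar>l z - f n z\<bar>" by (intro tendsto_intros lim z)
    show "\<exists>N. \<forall>m\<ge>N. \<bar>f m z - f n z\<bar> \<le> 2 * K0 / 2 ^ n * \<rho> z"
      using near[OF z, of n] by auto
  qed
  have "F l z = l z" if z: "z \<in> S" for z
  proof -
    have "\<bar>F l z - l z\<bar> \<le> 2 * K0 * \<rho> z / 2 ^ n" for n
    proof -
      have "\<bar>F l z - F (f n) z\<bar> \<le> 2 * K0 / 2 ^ n / 2 * \<rho> z"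
        by (rule contr) (use lP fP lf z in auto)
      then have "\<bar>F l z - f (Suc n) z\<bar> \<le> K0 * \<rho> z / 2 ^ n" by (simp add: f_def)
      moreover have "\<bar>l z - f (Suc n) z\<bar> \<le> K0 * \<rho> z / 2 ^ n" using lf[OF z, of "Suc n"] by simp
      moreover have "2 * K0 * \<rho> z / 2 ^ n = K0 * \<rho> z / 2 ^ n + K0 * \<rho> z / 2 ^ n" by simp
      ultimately show ?thesis by linarith
    qed
    then have "\<bar>F l z - l z\<bar> \<le> 0"
      by (intro LIMSEQ_le_const[OF van[of "2 * K0 * \<rho> z"]]) auto
    then show ?thesis by simp
  qed
  with lP show ?thesis by blast
qed

text \<open>Integrating \<open>exp (c * r)\<close> gains the factor \<open>1 / c\<close>; this is what makes integral operators
  contractions for exponential weights. Since \<open>C / c * exp (c * r)\<close> has derivative at least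
  \<open>\<bar>f' r\<bar>\<close>, both of its combinations with \<open>f\<close> and \<open>- f\<close> are monotone.\<close>

lemma abs_le_weighted_exp:
  fixes f f' :: "real \<Rightarrow> real"
  assumes deriv: "\<And>r. r \<in> {0..T} \<Longrightarrow> (f has_real_derivative f' r) (at r within {0..T})"
    and bound: "\<And>r. r \<in> {0..T} \<Longrightarrow> \<bar>f' r\<bar> \<le> C * exp (c * r)"
    and c: "c > 0" and t: "t \<in> {0..T}"
  shows "\<bar>f t\<bar> \<le> \<bar>f 0\<bar> + C / c * exp (c * t)"
proof -
  have C: "C \<ge> 0" using bound[of 0] t by simp
  have cont: "continuous_on {0..t} f"
    using DERIV_continuous_on[OF deriv] continuous_on_subset t by fastforce
  have D: "(f has_real_derivative f' r) (at r)" if "0 < r" "r < t" for r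
  proof -
    have "r \<in> interior {0..T}" using that t by simp
    then have "at r within {0..T} = at r" by (rule at_within_interior)
    then show ?thesis using deriv[of r] that t by simp
  qed
  have *: "\<sigma> * f t - \<sigma> * f 0 \<le> C / c * exp (c * t)" if \<sigma>: "\<sigma> = 1 \<or> \<sigma> = - 1" for \<sigma> :: real
  proof -
    have "C / c * exp (c * 0) - \<sigma> * f 0 \<le> C / c * exp (c * t) - \<sigma> * f t"
    proof (rule DERIV_nonneg_imp_increasing_open[where f = "\<lambda>r. C / c * exp (c * r) - \<sigma> * f r"])
      show "\<exists>y. ((\<lambda>r. C / c * exp (c * r) - \<sigma> * f r) has_real_derivative y) (at r) \<and> 0 \<le> y"
        if "0 < r" "r < t" for r
      proof (intro exI conjI)
        show "((\<lambda>r. C / c * exp (c * r) - \<sigma> * f r) has_real_derivative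
            C * exp (c * r) - \<sigma> * f' r) (at r)"
          using c by (auto intro!: derivative_eq_intros D[OF that])
        show "0 \<le> C * exp (c * r) - \<sigma> * f' r" using bound[of r] that t \<sigma> by auto
      qed
    qed (use t c in \<open>auto intro!: continuous_intros cont\<close>)
    moreover have "C / c * exp (c * 0) \<ge> 0" using C c by simp
    ultimately show ?thesis by linarith
  qed
  show ?thesis using *[of 1] *[of "- 1"] by linarith
qed

section \<open>The flow of a velocity field on the circle\<close>

definition regular_velocity :: "real \<Rightarrow> (circle \<Rightarrow> real \<Rightarrow> real) \<Rightarrow> bool"
  where "regular_velocity T v \<longleftrightarrow>
    (\<forall>p. \<forall>t\<in>{0..T}. \<bar>v p t\<bar> \<le> 1) \<and>
    (\<forall>p q. \<forall>t\<in>{0..T}. \<bar>v p t - v q t\<bar> \<le> dist p q) \<and>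
    (\<forall>p. continuous_on {0..T} (v p))"

text \<open>The real-valued lifts occurring in \<^const>\<open>circle_ode\<close>.\<close>

definition lift_solution :: "(circle \<Rightarrow> real \<Rightarrow> real) \<Rightarrow> real \<Rightarrow> (real \<Rightarrow> real) \<Rightarrow> bool"
  where "lift_solution v T w \<longleftrightarrow>
    (\<forall>r\<in>{0..T}. (w has_real_derivative v (abs_circle (w r)) r) (at r within {0..T}))"

lemma regular_velocity_lift_lipschitz:
  assumes "regular_velocity T v" "t \<in> {0..T}"
  shows "\<bar>v (abs_circle a) t - v (abs_circle b) t\<bar> \<le> \<bar>a - b\<bar>"
proof -
  have "\<bar>v (abs_circle a) t - v (abs_circle b) t\<bar> \<le> dist (abs_circle a) (abs_circle b)"
    using assms by (simp add: regular_velocity_def)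
  then show ?thesis using dist_abs_circle_le[of a b] by linarith
qed

text \<open>A field that is Lipschitz in the position, uniformly in time, and continuous in time is jointly
  continuous.\<close>

lemma continuous_on_velocity_along:
  assumes v: "regular_velocity T v" and w: "continuous_on {0..T} w"
  shows "continuous_on {0..T} (\<lambda>s. v (abs_circle (w s)) s)"
  unfolding continuous_on
proof
  fix t assume t: "t \<in> {0..T}"
  have 1: "((\<lambda>s. \<bar>w s - w t\<bar> + \<bar>v (abs_circle (w t)) s - v (abs_circle (w t)) t\<bar>)
      \<longlongrightarrow> \<bar>w t - w t\<bar> + \<bar>v (abs_circle (w t)) t - v (abs_circle (w t)) t\<bar>) (at t within {0..T})"
    using w v t by (intro tendsto_intros) (auto simp: continuous_on regular_velocity_def)
  have 2: "eventually (\<lambda>s. \<bar>v (abs_circle (w s)) s - v (abs_circle (w t)) t\<bar>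
      \<le> \<bar>w s - w t\<bar> + \<bar>v (abs_circle (w t)) s - v (abs_circle (w t)) t\<bar>) (at t within {0..T})"
    unfolding eventually_at_filter
  proof (intro always_eventually allI impI)
    fix s assume "s \<in> {0..T}"
    from regular_velocity_lift_lipschitz[OF v this, of "w s" "w t"]
    show "\<bar>v (abs_circle (w s)) s - v (abs_circle (w t)) t\<bar>
      \<le> \<bar>w s - w t\<bar> + \<bar>v (abs_circle (w t)) s - v (abs_circle (w t)) t\<bar>" by linarith
  qed
  have "((\<lambda>s. v (abs_circle (w s)) s - v (abs_circle (w t)) t) \<longlongrightarrow> 0) (at t within {0..T})"
    by (rule Lim_null_comparison[OF _ 1[simplified]]) (use 2 in \<open>simp add: real_norm_def\<close>)
  then show "((\<lambda>s. v (abs_circle (w s)) s) \<longlongrightarrow> v (abs_circle (w t)) t) (at t within {0..T})"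
    by (simp add: LIM_zero_iff)
qed

lemma lift_solution_lipschitz:
  assumes v: "regular_velocity T v" and w: "lift_solution v T w"
    and st: "s \<in> {0..T}" "t \<in> {0..T}"
  shows "\<bar>w t - w s\<bar> \<le> \<bar>t - s\<bar>"
proof -
  have "norm (w t - w s) \<le> 1 * norm (t - s)"
    by (rule field_differentiable_bound[of "{0..T}"])
      (use v w st in \<open>auto simp: lift_solution_def regular_velocity_def\<close>)
  then show ?thesis by simp
qed

text \<open>Picard iteration. Speed at most 1 makes every iterate 1-Lipschitz, and unlike
  continuity this property survives pointwise limits. The weight \<open>exp (2 * t)\<close> yields the factor
  one half.\<close>

lemma lift_solution_exists:
  assumes v: "regular_velocity T v" and T: "T > 0"
  shows "\<exists>w. lift_solution v T w \<and> w 0 = a"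
proof -
  define S where "S = {0..T}"
  define P where "P = {w :: real \<Rightarrow> real. \<forall>s\<in>S. \<forall>t\<in>S. \<bar>w t - w s\<bar> \<le> \<bar>t - s\<bar>}"
  define F where "F w t = a + integral {0..t} (\<lambda>s. v (abs_circle (w s)) s)" for w t
  have cont: "continuous_on {0..T} (\<lambda>s. v (abs_circle (w s)) s)" if "w \<in> P" for w
  proof (rule continuous_on_velocity_along[OF v])
    have "1-lipschitz_on {0..T} w"
      using that by (auto simp: P_def S_def lipschitz_on_def dist_real_def abs_minus_commute)
    then show "continuous_on {0..T} w" by (rule lipschitz_on_continuous_on)
  qed
  have F': "(F w has_real_derivative v (abs_circle (w t)) t) (at t within {0..T})"
    if "w \<in> P" "t \<in> {0..T}" for w t
    unfolding F_def
    using integral_has_real_derivative[OF cont[OF that(1)] that(2)]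
    by (auto intro!: derivative_eq_intros)
  have F0: "F w 0 = a" for w by (simp add: F_def)
  have "\<exists>w\<in>P. \<forall>t\<in>S. F w t = w t"
  proof (rule weighted_contraction_fixed_point[where \<rho> = "\<lambda>t. exp (2 * t)"
        and ?f0.0 = "\<lambda>_. a" and ?K0.0 = T])
    fix f :: "nat \<Rightarrow> real \<Rightarrow> real" and l
    assume f: "\<And>n. f n \<in> P" and l: "\<And>t. t \<in> S \<Longrightarrow> (\<lambda>n. f n t) \<longlonglongrightarrow> l t"
    show "l \<in> P" unfolding P_def
    proof (intro CollectI ballI)
      fix s t assume "s \<in> S" "t \<in> S"
      then show "\<bar>l t - l s\<bar> \<le> \<bar>t - s\<bar>"
        using f by (intro LIMSEQ_le_const2[of "\<lambda>n. \<bar>f n t - f n s\<bar>"] tendsto_intros l)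
          (auto simp: P_def)
    qed
  next
    fix w assume w: "w \<in> P"
    show FP: "F w \<in> P" unfolding P_def
    proof (intro CollectI ballI)
      fix s t assume "s \<in> S" "t \<in> S"
      then have "norm (F w t - F w s) \<le> 1 * norm (t - s)"
        using v unfolding S_def
        by (intro field_differentiable_bound[OF _ F'[OF w]]) (auto simp: regular_velocity_def)
      then show "\<bar>F w t - F w s\<bar> \<le> \<bar>t - s\<bar>" by simp
    qed
    fix z K t
    assume z: "z \<in> P" and K: "\<And>r. r \<in> S \<Longrightarrow> \<bar>w r - z r\<bar> \<le> K * exp (2 * r)" and t: "t \<in> S"
    have "\<bar>F w t - F z t\<bar> \<le> \<bar>F w 0 - F z 0\<bar> + K / 2 * exp (2 * t)"
    proof (rule abs_le_weighted_exp[where f = "\<lambda>t. F w t - F z t" and T = T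
          and f' = "\<lambda>r. v (abs_circle (w r)) r - v (abs_circle (z r)) r"])
      show "\<bar>v (abs_circle (w r)) r - v (abs_circle (z r)) r\<bar> \<le> K * exp (2 * r)"
        if "r \<in> {0..T}" for r
        using regular_velocity_lift_lipschitz[OF v that, of "w r" "z r"] K[of r] that
        unfolding S_def by linarith
    qed (use t F' w z in \<open>auto simp: S_def intro!: derivative_eq_intros\<close>)
    then show "\<bar>F w t - F z t\<bar> \<le> K / 2 * exp (2 * t)" by (simp add: F0)
  next
    show c: "(\<lambda>_. a) \<in> P" by (simp add: P_def)
    fix t assume t: "t \<in> S"
    have "norm (F (\<lambda>_. a) t - F (\<lambda>_. a) 0) \<le> 1 * norm (t - 0)"
      using v t T unfolding S_def
      by (intro field_differentiable_bound[OF _ F'[OF c]]) (auto simp: regular_velocity_def)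
    also have "\<dots> \<le> T * exp (2 * t)"
      using t T unfolding S_def by (auto intro: order_trans[OF _ mult_left_mono[of 1]])
    finally show "\<bar>F (\<lambda>_. a) t - a\<bar> \<le> T * exp (2 * t)" by (simp add: F0)
  qed
  then obtain w where w: "w \<in> P" "\<And>t. t \<in> {0..T} \<Longrightarrow> F w t = w t" unfolding S_def by auto
  have "lift_solution v T w"
    unfolding lift_solution_def
  proof
    fix r assume r: "r \<in> {0..T}"
    show "(w has_real_derivative v (abs_circle (w r)) r) (at r within {0..T})"
      by (rule has_field_derivative_transform_within[OF F'[OF w(1) r], where d = 1])
        (use w(2) r in auto)
  qed
  moreover have "w 0 = a" using w(2)[of 0] F0 T by simp
  ultimately show ?thesis by blast
qed

text \<open>A Gronwall estimate in the weighted norm. If \<open>N\<close> is the maximum of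
  \<open>exp (- 3 t) \<bar>w1 t - w2 t\<bar>\<close>, then the derivative of the difference is at most
  \<open>(N + K) exp (3 t)\<close>, and integrating returns
  \<open>N \<le> \<bar>w1 0 - w2 0\<bar> + (N + K) / 3\<close>, which can be solved for \<open>N\<close>.
  The exponent 3 is chosen to make the coefficient of \<open>K\<close> equal to one half.\<close>

lemma lift_solution_compare:
  assumes v1: "regular_velocity T v1"
    and w1: "lift_solution v1 T w1" and w2: "lift_solution v2 T w2"
    and near: "\<And>p r. r \<in> {0..T} \<Longrightarrow> \<bar>v1 p r - v2 p r\<bar> \<le> K * exp (3 * r)"
    and t: "t \<in> {0..T}"
  shows "\<bar>w1 t - w2 t\<bar> \<le> (3 / 2 * \<bar>w1 0 - w2 0\<bar> + K / 2) * exp (3 * t)"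
proof -
  define h where "h r = exp (- (3 * r)) * \<bar>w1 r - w2 r\<bar>" for r
  have "continuous_on {0..T} w" if "lift_solution v T w" for v w
    using that by (intro DERIV_continuous_on) (auto simp: lift_solution_def)
  then have "continuous_on {0..T} h"
    unfolding h_def using w1 w2 by (intro continuous_intros) auto
  moreover have "{0..T} \<noteq> {}" using t by auto
  ultimately obtain r0 where r0: "r0 \<in> {0..T}" "\<And>r. r \<in> {0..T} \<Longrightarrow> h r \<le> h r0"
    using continuous_attains_sup[of "{0..T}" h] by auto
  define N where "N = h r0"
  have le: "\<bar>w1 r - w2 r\<bar> \<le> N * exp (3 * r)" if "r \<in> {0..T}" for r
  proof -
    have "h r \<le> N" unfolding N_def by (rule r0(2)[OF that])
    then show ?thesis unfolding h_def by (simp add: exp_minus field_simps)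
  qed
  have grow: "\<bar>w1 r - w2 r\<bar> \<le> \<bar>w1 0 - w2 0\<bar> + (N + K) / 3 * exp (3 * r)" if "r \<in> {0..T}" for r
  proof (rule abs_le_weighted_exp[where f = "\<lambda>t. w1 t - w2 t" and T = T
        and f' = "\<lambda>r. v1 (abs_circle (w1 r)) r - v2 (abs_circle (w2 r)) r"])
    show "\<bar>v1 (abs_circle (w1 r)) r - v2 (abs_circle (w2 r)) r\<bar> \<le> (N + K) * exp (3 * r)"
      if "r \<in> {0..T}" for r
      using regular_velocity_lift_lipschitz[OF v1 that, of "w1 r" "w2 r"] le[OF that]
        near[OF that, of "abs_circle (w2 r)"]
      by (simp add: distrib_right)
  qed (use that w1 w2 in \<open>auto simp: lift_solution_def intro!: derivative_eq_intros\<close>)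
  have "N \<le> \<bar>w1 0 - w2 0\<bar> + (N + K) / 3"
  proof -
    have e: "exp (- (3 * r0)) \<le> 1" using r0(1) by simp
    have "N \<le> exp (- (3 * r0)) * (\<bar>w1 0 - w2 0\<bar> + (N + K) / 3 * exp (3 * r0))"
      unfolding N_def h_def using grow[OF r0(1)] unfolding N_def h_def by (intro mult_left_mono) auto
    also have "\<dots> = exp (- (3 * r0)) * \<bar>w1 0 - w2 0\<bar> + (N + K) / 3"
      by (simp add: exp_minus field_simps)
    also have "\<dots> \<le> \<bar>w1 0 - w2 0\<bar> + (N + K) / 3"
      using mult_right_mono[OF e, of "\<bar>w1 0 - w2 0\<bar>"] by simp
    finally show ?thesis .
  qed
  then have "N \<le> 3 / 2 * \<bar>w1 0 - w2 0\<bar> + K / 2" by (simp add: field_simps)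
  then have "N * exp (3 * t) \<le> (3 / 2 * \<bar>w1 0 - w2 0\<bar> + K / 2) * exp (3 * t)"
    by (intro mult_right_mono) auto
  with le[OF t] show ?thesis by linarith
qed

text \<open>The definite description in \<^const>\<open>flow\<close> is meaningful: the lifts of two solutions with the
  same initial point start at distance a multiple of \<open>2\<pi>\<close>, and translating one of them by this
  multiple gives another lift solution, which the Gronwall estimate with \<open>K = 0\<close> identifies with
  the other.\<close>

lemma flow_abs_circle:
  assumes v: "regular_velocity T v" and w: "lift_solution v T w" and t: "t \<in> {0..T}"
  shows "flow v T t 0 (abs_circle (w 0)) = abs_circle (w t)"
  unfolding flow_def
proof (rule the_equality)
  show "\<exists>u. circle_ode v T u \<and> u 0 = abs_circle (w 0) \<and> u t = abs_circle (w t)"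
    using w by (intro exI[of _ "\<lambda>r. abs_circle (w r)"])
      (auto simp: circle_ode_def lift_solution_def intro!: exI[of _ w])
next
  fix p assume "\<exists>u. circle_ode v T u \<and> u 0 = abs_circle (w 0) \<and> u t = p"
  then obtain u where u: "circle_ode v T u" "u 0 = abs_circle (w 0)" "u t = p" by blast
  then obtain z where z: "\<And>r. r \<in> {0..T} \<Longrightarrow> u r = abs_circle (z r)" and "lift_solution v T z"
    unfolding circle_ode_def lift_solution_def by fastforce
  have "abs_circle (w 0) = abs_circle (z 0)" using u(2) z[of 0] t by simp
  then obtain k where k: "z 0 = w 0 + 2 * pi * of_int k" by (rule abs_circle_eqE)
  define y where "y = (\<lambda>r. z r + 2 * pi * of_int (- k))"
  have yz: "abs_circle (y r) = abs_circle (z r)" for r unfolding y_def by (rule abs_circle_shift)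
  have "lift_solution v T y"
    using \<open>lift_solution v T z\<close> unfolding lift_solution_def yz unfolding y_def
    by (auto intro!: derivative_eq_intros)
  then have "\<bar>w t - y t\<bar> \<le> (3 / 2 * \<bar>w 0 - y 0\<bar> + 0 / 2) * exp (3 * t)"
    by (intro lift_solution_compare[OF v w _ _ t]) auto
  moreover have "y 0 = w 0" by (simp add: y_def k)
  ultimately have "w t = y t" by simp
  then show "p = abs_circle (w t)" using yz[of t] z[OF t] u(3) by simp
qed

text \<open>With equal fields this is the Lipschitz bound of the flow in its initial point; with equal
  initial points it bounds the effect of perturbing the field, be it between two fields of the
  fixed point argument or between two labels of the same field.\<close>

lemma flow_compare:
  assumes v1: "regular_velocity T v1" and v2: "regular_velocity T v2"
    and near: "\<And>p r. r \<in> {0..T} \<Longrightarrow> \<bar>v1 p r - v2 p r\<bar> \<le> K * exp (3 * r)"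
    and t: "t \<in> {0..T}" and T: "T > 0"
  shows "dist (flow v1 T t 0 p) (flow v2 T t 0 q) \<le> (3 / 2 * dist p q + K / 2) * exp (3 * t)"
proof -
  obtain a b where ab: "p = abs_circle a" "q = abs_circle b" "\<bar>a - b\<bar> = dist p q"
    by (rule circle_lifts_at_distance)
  obtain w1 where w1: "lift_solution v1 T w1" "w1 0 = a"
    using lift_solution_exists[OF v1 T] by blast
  obtain w2 where w2: "lift_solution v2 T w2" "w2 0 = b"
    using lift_solution_exists[OF v2 T] by blast
  have "dist (flow v1 T t 0 p) (flow v2 T t 0 q) = dist (abs_circle (w1 t)) (abs_circle (w2 t))"
    using flow_abs_circle[OF v1 w1(1) t] flow_abs_circle[OF v2 w2(1) t] w1(2) w2(2) ab by simp
  also have "\<dots> \<le> \<bar>w1 t - w2 t\<bar>" by (rule dist_abs_circle_le)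
  also have "\<dots> \<le> (3 / 2 * \<bar>w1 0 - w2 0\<bar> + K / 2) * exp (3 * t)"
    by (rule lift_solution_compare[OF v1 w1(1) w2(1) near t])
  finally show ?thesis using w1(2) w2(2) ab(3) by simp
qed

lemma flow_speed:
  assumes v: "regular_velocity T v" and T: "T > 0" and st: "s \<in> {0..T}" "t \<in> {0..T}"
  shows "dist (flow v T t 0 p) (flow v T s 0 p) \<le> \<bar>t - s\<bar>"
proof -
  obtain w where w: "lift_solution v T w" "w 0 = angle p"
    using lift_solution_exists[OF v T] by blast
  have "flow v T r 0 p = abs_circle (w r)" if "r \<in> {0..T}" for r
    using flow_abs_circle[OF v w(1) that] w(2) by (simp add: abs_circle_angle)
  then show ?thesis
    using dist_abs_circle_le[of "w t" "w s"] lift_solution_lipschitz[OF v w(1) st] st by simp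
qed

lemma flow_lipschitz:
  assumes v: "regular_velocity T v" and T: "T > 0" and t: "t \<in> {0..T}"
  shows "(3 / 2 * exp (3 * t))-lipschitz_on UNIV (flow v T t 0)"
  using flow_compare[OF v v, of 0, OF _ t T] by (intro lipschitz_onI) (auto simp: mult_ac)

lemma flow_cong:
  assumes "\<And>p r. r \<in> {0..T} \<Longrightarrow> v1 p r = v2 p r"
  shows "flow v1 T = flow v2 T"
proof -
  have "circle_ode v1 T = circle_ode v2 T"
    unfolding circle_ode_def fun_eq_iff using assms by (metis (no_types, lifting))
  then show ?thesis unfolding flow_def fun_eq_iff by simp
qed

section \<open>Transport of probability measures on the circle\<close>

lemma abs_integral_diff_le:
  fixes f g :: "'a \<Rightarrow> real"
  assumes "prob_space M" "integrable M f" "integrable M g"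
    and "\<And>u. u \<in> space M \<Longrightarrow> \<bar>f u - g u\<bar> \<le> c"
  shows "\<bar>(LINT u|M. f u) - (LINT u|M. g u)\<bar> \<le> c"
proof -
  interpret prob_space M by fact
  have "\<bar>(LINT u|M. f u) - (LINT u|M. g u)\<bar> = \<bar>LINT u|M. f u - g u\<bar>"
    using assms by simp
  also have "\<dots> \<le> (LINT u|M. c)"
    by (rule integral_abs_bound[THEN order_trans], rule integral_mono) (use assms in auto)
  also have "\<dots> = c" using prob_space by simp
  finally show ?thesis .
qed

lemma lipschitz_integral_diff_le_scaled:
  assumes f: "L-lipschitz_on UNIV (f :: circle \<Rightarrow> real)" and L: "L > 0"
  shows "\<bar>(LINT u|meas \<mu>. f u) - (LINT u|meas \<eta>. f u)\<bar> \<le> L * dist \<mu> \<eta>"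
proof -
  have "1-lipschitz_on UNIV (\<lambda>u. f u / L)"
    using lipschitz_onD[OF f] L
    by (intro lipschitz_onI)
      (auto simp: dist_real_def diff_divide_distrib[symmetric] pos_divide_le_eq mult.commute)
  from lipschitz_integral_diff_le_dist[OF this, of \<mu> \<eta>] L show ?thesis
    by (simp add: diff_divide_distrib[symmetric] pos_divide_le_eq mult.commute)
qed

definition push :: "(circle \<Rightarrow> circle) \<Rightarrow> circle_prob \<Rightarrow> circle_prob"
  where "push \<Phi> \<mu> = Abs_circle_prob (distr (meas \<mu>) borel \<Phi>)"

lemma lipschitz_circle_map_measurable:
  "L-lipschitz_on UNIV \<Phi> \<Longrightarrow> (\<Phi> :: circle \<Rightarrow> circle) \<in> borel_measurable borel"
  by (intro borel_measurable_continuous_onI lipschitz_on_continuous_on)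

lemma meas_push:
  assumes [measurable]: "\<Phi> \<in> borel_measurable borel"
  shows "meas (push \<Phi> \<mu>) = distr (meas \<mu>) borel \<Phi>"
  unfolding push_def
  by (subst Abs_circle_prob_inverse)
    (auto intro: prob_space.prob_space_distr[OF prob_space_meas])

lemma integral_push:
  fixes f :: "circle \<Rightarrow> real"
  assumes [measurable]: "\<Phi> \<in> borel_measurable borel" "f \<in> borel_measurable borel"
  shows "(LINT u|meas (push \<Phi> \<mu>). f u) = (LINT u|meas \<mu>. f (\<Phi> u))"
  by (simp add: meas_push integral_distr)

text \<open>Composing a 1-Lipschitz test function with \<open>\<Phi>\<close> or with \<open>\<Psi>\<close> changes its values by at
  most \<open>c\<close>, so pushing forward by uniformly close maps gives close measures.\<close>

lemma dist_push_maps_le: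
  assumes \<Phi>: "L-lipschitz_on UNIV \<Phi>" and \<Psi>: "L'-lipschitz_on UNIV \<Psi>"
    and c: "\<And>u. dist (\<Phi> u) (\<Psi> u) \<le> c"
  shows "dist (push \<Phi> \<mu>) (push \<Psi> \<mu>) \<le> c"
proof (rule dist_circle_prob_leI)
  fix f :: "circle \<Rightarrow> real" assume f: "1-lipschitz_on UNIV f"
  have int: "integrable (meas \<mu>) (\<lambda>u. f (\<Phi> u))" "integrable (meas \<mu>) (\<lambda>u. f (\<Psi> u))"
    using lipschitz_circle_meas(2) lipschitz_on_compose2[OF \<Phi> lipschitz_on_subset[OF f]]
      lipschitz_on_compose2[OF \<Psi> lipschitz_on_subset[OF f]] by blast+
  have "\<bar>(LINT u|meas \<mu>. f (\<Phi> u)) - (LINT u|meas \<mu>. f (\<Psi> u))\<bar> \<le> c"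
  proof (rule abs_integral_diff_le[OF prob_space_meas int])
    show "\<bar>f (\<Phi> u) - f (\<Psi> u)\<bar> \<le> c" for u
      using lipschitz_onD[OF f, of "\<Phi> u" "\<Psi> u"] c[of u] by (simp add: dist_real_def)
  qed
  then show "\<bar>(LINT u|meas (push \<Phi> \<mu>). f u) - (LINT u|meas (push \<Psi> \<mu>). f u)\<bar> \<le> c"
    by (simp add: integral_push lipschitz_circle_map_measurable[OF \<Phi>]
        lipschitz_circle_map_measurable[OF \<Psi>] lipschitz_circle_meas[OF f])
qed

lemma dist_push_measures_le:
  assumes \<Phi>: "L-lipschitz_on UNIV \<Phi>" and L: "L > 0"
  shows "dist (push \<Phi> \<mu>) (push \<Phi> \<eta>) \<le> L * dist \<mu> \<eta>"
proof (rule dist_circle_prob_leI)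
  fix f :: "circle \<Rightarrow> real" assume f: "1-lipschitz_on UNIV f"
  have "L-lipschitz_on UNIV (\<lambda>u. f (\<Phi> u))"
    using lipschitz_on_compose2[OF \<Phi> lipschitz_on_subset[OF f]] by simp
  from lipschitz_integral_diff_le_scaled[OF this L]
  show "\<bar>(LINT u|meas (push \<Phi> \<mu>). f u) - (LINT u|meas (push \<Phi> \<eta>). f u)\<bar> \<le> L * dist \<mu> \<eta>"
    by (simp add: integral_push lipschitz_circle_map_measurable[OF \<Phi>] lipschitz_circle_meas[OF f])
qed

text \<open>A function of two variables that is continuous in each of them separately sends a
  measurable map to a measurable function: replacing the first argument by its rounding \<open>\<lfloor>N x\<rfloor> / N\<close> leaves countably many continuous functions of that map, and continuity
  in the first argument lets N tend to infinity. The clamping to the unit interval concerns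
  integers that are no such rounding.\<close>

lemma caratheodory_measurable:
  fixes h :: "real \<Rightarrow> 'b :: metric_space \<Rightarrow> 'c :: metric_space"
  assumes g: "g \<in> borel_measurable I_leb"
    and h1: "\<And>x. x \<in> {0..1} \<Longrightarrow> continuous_on UNIV (h x)"
    and h2: "\<And>z. continuous_on {0..1} (\<lambda>x. h x z)"
  shows "(\<lambda>x. h x (g x)) \<in> borel_measurable I_leb"
proof -
  define q where "q n x = \<lfloor>real (Suc n) * x\<rfloor>" for n and x :: real
  define r where "r n i = max 0 (min 1 (of_int i / real (Suc n)))" for n and i :: int
  have r: "r n i \<in> {0..1}" for n i by (auto simp: r_def)
  have id: "(\<lambda>x. x) \<in> borel_measurable I_leb"
    by (rule measurable_restrict_space1) (rule measurable_completion, simp)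
  show ?thesis
  proof (rule borel_measurable_LIMSEQ_metric)
    fix n
    have "(\<lambda>x. q n x) \<in> I_leb \<rightarrow>\<^sub>M count_space UNIV"
      unfolding q_def by (rule measurable_compose[OF id]) measurable
    moreover have "(\<lambda>x. h (r n i) (g x)) \<in> borel_measurable I_leb" for i
      using measurable_compose[OF g borel_measurable_continuous_onI[OF h1[OF r]]] by simp
    ultimately show "(\<lambda>x. h (r n (q n x)) (g x)) \<in> borel_measurable I_leb"
      by (intro measurable_compose_countable[where g = "q n" and f = "\<lambda>i x. h (r n i) (g x)"])
  next
    fix x assume "x \<in> space I_leb"
    then have x: "x \<in> {0..1}" by simp
    have close: "\<bar>r n (q n x) - x\<bar> \<le> 1 / real (Suc n)" for n
    proof -
      let ?N = "real (Suc n)"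
      have N: "?N > 0" by simp
      have 1: "of_int (q n x) \<le> ?N * x" "?N * x < of_int (q n x) + 1"
        unfolding q_def by linarith+
      have 2: "of_int (q n x) / ?N \<le> x"
        using 1(1) N by (simp add: pos_divide_le_eq mult.commute del: of_nat_Suc)
      have 3: "x \<le> of_int (q n x) / ?N + 1 / ?N"
        using 1(2) N by (simp add: add_divide_distrib[symmetric] pos_le_divide_eq mult.commute
            del: of_nat_Suc)
      have "q n x \<ge> 0" using x by (simp add: q_def)
      then have "of_int (q n x) / ?N \<ge> 0" by simp
      then have "r n (q n x) = of_int (q n x) / ?N" using 2 x by (simp add: r_def del: of_nat_Suc)
      with 2 3 show ?thesis by linarith
    qed
    have "(\<lambda>n. r n (q n x) - x) \<longlonglongrightarrow> 0"
      by (rule Lim_null_comparison[OF _ LIMSEQ_inverse_real_of_nat])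
        (use close in \<open>auto intro!: always_eventually simp: inverse_eq_divide\<close>)
    then have "(\<lambda>n. r n (q n x)) \<longlonglongrightarrow> x" by (simp add: LIM_zero_iff)
    then show "(\<lambda>n. h (r n (q n x)) (g x)) \<longlonglongrightarrow> h x (g x)"
      by (intro continuous_on_tendsto_compose[OF h2]) (use x r in auto)
  qed
qed

section \<open>The mean-field velocity and its regularity\<close>

definition observe :: "(circle \<Rightarrow> real) \<Rightarrow> circle \<Rightarrow> circle_prob \<Rightarrow> real"
  where "observe D u \<mu> = (LINT v|meas \<mu>. D (v - u))"

text \<open>This \<open>L\<^sup>1\<close> distance of two sections of W bounds, uniformly in time and position, how much any
  mean-field velocity can change between two labels.\<close>

definition W_modulus :: "(real \<Rightarrow> real \<Rightarrow> real) \<Rightarrow> real \<Rightarrow> real \<Rightarrow> real"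
  where "W_modulus W x x' = (LINT y|I_leb. \<bar>W x y - W x' y\<bar>)"

definition mean_field :: "(real \<Rightarrow> real \<Rightarrow> real) \<Rightarrow> (circle \<Rightarrow> real) \<Rightarrow> (real \<Rightarrow> circle_prob) \<Rightarrow>
    circle \<Rightarrow> real \<Rightarrow> real"
  where "mean_field W D m u x = (LINT y|I_leb. W x y * observe D u (m y))"

locale graphon_interaction =
  fixes W :: "real \<Rightarrow> real \<Rightarrow> real" and D :: "circle \<Rightarrow> real" and T :: real
  assumes W_section_meas: "\<And>x. x \<in> {0..1} \<Longrightarrow> W x \<in> borel_measurable I_leb"
    and W_bound: "\<And>x y. x \<in> {0..1} \<Longrightarrow> y \<in> {0..1} \<Longrightarrow> \<bar>W x y\<bar> \<le> 1"
    and W_cont: "\<And>x. x \<in> {0..1} \<Longrightarrow> ((\<lambda>x'. W_modulus W x' x) \<longlongrightarrow> 0) (at x within {0..1})"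
    and D_bound: "\<And>u. \<bar>D u\<bar> \<le> 1"
    and D_lipschitz: "1-lipschitz_on UNIV D"
    and T_pos: "T > 0"
begin

lemma D_translate_lipschitz: "1-lipschitz_on UNIV (\<lambda>v. D (v - u))"
proof (rule lipschitz_onI)
  fix v w
  show "dist (D (v - u)) (D (w - u)) \<le> 1 * dist v w"
    using lipschitz_onD[OF D_lipschitz, of "v - u" "w - u"] dist_circle_diff_right[of v u w] by simp
qed simp

lemma observe_bound: "\<bar>observe D u \<mu>\<bar> \<le> 1"
  using abs_integral_diff_le[OF prob_space_meas lipschitz_circle_meas(2)[OF D_translate_lipschitz],
      where g = "\<lambda>_. 0" and c = 1] D_bound
  by (simp add: observe_def)

lemma observe_lipschitz_position: "\<bar>observe D u \<mu> - observe D u' \<mu>\<bar> \<le> dist u u'"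
  unfolding observe_def
proof (rule abs_integral_diff_le[OF prob_space_meas])
  fix v
  have "\<bar>D (v - u) - D (v - u')\<bar> \<le> dist (v - u) (v - u')"
    using lipschitz_onD[OF D_lipschitz, of "v - u" "v - u'"] by (simp add: dist_real_def)
  then show "\<bar>D (v - u) - D (v - u')\<bar> \<le> dist u u'" using dist_circle_diff_left[of v u u'] by linarith
qed (rule lipschitz_circle_meas(2)[OF D_translate_lipschitz])+

lemma observe_lipschitz_measure: "\<bar>observe D u \<mu> - observe D u \<eta>\<bar> \<le> dist \<mu> \<eta>"
  unfolding observe_def by (rule lipschitz_integral_diff_le_dist[OF D_translate_lipschitz])

lemma observe_measurable:
  assumes "m \<in> borel_measurable I_leb"
  shows "(\<lambda>y. observe D u (m y)) \<in> borel_measurable I_leb"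
proof -
  have "1-lipschitz_on UNIV (observe D u)"
    using observe_lipschitz_measure by (intro lipschitz_onI) (auto simp: dist_real_def)
  then have "observe D u \<in> borel_measurable borel"
    by (intro borel_measurable_continuous_onI lipschitz_on_continuous_on)
  from measurable_compose[OF assms this] show ?thesis .
qed

lemma W_section_integrable:
  assumes x: "x \<in> {0..1}" and a: "a \<in> borel_measurable I_leb" "\<And>y. \<bar>a y\<bar> \<le> 1"
  shows "integrable I_leb (\<lambda>y. W x y * a y)"
proof -
  interpret prob_space I_leb by (rule prob_space_I_leb)
  show ?thesis
  proof (rule integrable_const_bound[where B = 1])
    show "(\<lambda>y. W x y * a y) \<in> borel_measurable I_leb"
      using W_section_meas[OF x] a(1) by (rule borel_measurable_times)
    have "\<bar>W x y * a y\<bar> \<le> 1" if "y \<in> {0..1}" for y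
      using mult_mono[OF W_bound[OF x that] a(2)[of y]] by (simp add: abs_mult)
    then show "AE y in I_leb. norm (W x y * a y) \<le> 1" by (intro AE_I2) auto
  qed
qed

lemma mean_field_integrable:
  assumes "m \<in> borel_measurable I_leb" "x \<in> {0..1}"
  shows "integrable I_leb (\<lambda>y. W x y * observe D u (m y))"
  using assms by (intro W_section_integrable observe_measurable observe_bound)

lemma W_modulus_integrable:
  assumes "x \<in> {0..1}" "x' \<in> {0..1}"
  shows "integrable I_leb (\<lambda>y. \<bar>W x y - W x' y\<bar>)"
  using W_section_integrable[OF assms(1), of "\<lambda>_. 1"] W_section_integrable[OF assms(2), of "\<lambda>_. 1"]
  by (intro integrable_abs Bochner_Integration.integrable_diff) simp_all

lemma mean_field_bound:
  assumes m: "m \<in> borel_measurable I_leb" and x: "x \<in> {0..1}"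
  shows "\<bar>mean_field W D m u x\<bar> \<le> 1"
proof -
  have "\<bar>W x y * observe D u (m y)\<bar> \<le> 1" if "y \<in> {0..1}" for y
    using mult_mono[OF W_bound[OF x that] observe_bound[of u "m y"]] by (simp add: abs_mult)
  then show ?thesis
    using abs_integral_diff_le[OF prob_space_I_leb mean_field_integrable[OF m x],
        where g = "\<lambda>_. 0" and c = 1]
    by (simp add: mean_field_def)
qed

lemma mean_field_diff_le_integral:
  assumes m: "m \<in> borel_measurable I_leb" and n: "n \<in> borel_measurable I_leb" and x: "x \<in> {0..1}"
    and g: "integrable I_leb g"
    and le: "\<And>y. y \<in> {0..1} \<Longrightarrow> \<bar>observe D u (m y) - observe D u' (n y)\<bar> \<le> g y"
  shows "\<bar>mean_field W D m u x - mean_field W D n u' x\<bar> \<le> (LINT y|I_leb. g y)"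
proof -
  note int = mean_field_integrable[OF m x, of u] mean_field_integrable[OF n x, of u']
  have "\<bar>mean_field W D m u x - mean_field W D n u' x\<bar>
      = \<bar>LINT y|I_leb. W x y * observe D u (m y) - W x y * observe D u' (n y)\<bar>"
    using int by (simp add: mean_field_def)
  also have "\<dots> \<le> (LINT y|I_leb. g y)"
  proof (rule integral_abs_bound[THEN order_trans], rule integral_mono)
    fix y assume "y \<in> space I_leb"
    then have y: "y \<in> {0..1}" by simp
    have "\<bar>W x y\<bar> * \<bar>observe D u (m y) - observe D u' (n y)\<bar> \<le> 1 * g y"
      using W_bound[OF x y] le[OF y] by (intro mult_mono) auto
    then show "\<bar>W x y * observe D u (m y) - W x y * observe D u' (n y)\<bar> \<le> g y"
      by (simp add: abs_mult[symmetric] right_diff_distrib)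
  qed (use int g in auto)
  finally show ?thesis .
qed

lemma mean_field_diff_le_const:
  assumes m: "m \<in> borel_measurable I_leb" and n: "n \<in> borel_measurable I_leb" and x: "x \<in> {0..1}"
    and le: "\<And>y. y \<in> {0..1} \<Longrightarrow> \<bar>observe D u (m y) - observe D u' (n y)\<bar> \<le> c"
  shows "\<bar>mean_field W D m u x - mean_field W D n u' x\<bar> \<le> c"
proof -
  interpret prob_space I_leb by (rule prob_space_I_leb)
  show ?thesis using mean_field_diff_le_integral[OF m n x _ le] prob_space by simp
qed

text \<open>The observed averages are bounded by 1 and enter both velocities with the same values, so
  only the sections of W differ.\<close>

lemma mean_field_diff_label:
  assumes m: "m \<in> borel_measurable I_leb" and x: "x \<in> {0..1}" "x' \<in> {0..1}"
  shows "\<bar>mean_field W D m u x - mean_field W D m u x'\<bar> \<le> W_modulus W x x'"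
proof -
  note int = mean_field_integrable[OF m x(1), of u] mean_field_integrable[OF m x(2), of u]
  have "\<bar>mean_field W D m u x - mean_field W D m u x'\<bar>
      = \<bar>LINT y|I_leb. W x y * observe D u (m y) - W x' y * observe D u (m y)\<bar>"
    using int by (simp add: mean_field_def)
  also have "\<dots> \<le> W_modulus W x x'"
    unfolding W_modulus_def
  proof (rule integral_abs_bound[THEN order_trans], rule integral_mono)
    show "\<bar>W x y * observe D u (m y) - W x' y * observe D u (m y)\<bar> \<le> \<bar>W x y - W x' y\<bar>" for y
      using mult_left_mono[OF observe_bound[of u "m y"], of "\<bar>W x y - W x' y\<bar>"]
      by (simp add: abs_mult[symmetric] left_diff_distrib)
  qed (use int W_modulus_integrable[OF x] in auto)
  finally show ?thesis .
qed

text \<open>The properties shared by the velocity field of any continuous curve of families; they are what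
  the flows and their measurability in the label rely on.\<close>

definition regular_field :: "(circle \<Rightarrow> real \<Rightarrow> real \<Rightarrow> real) \<Rightarrow> bool"
  where "regular_field V \<longleftrightarrow> (\<forall>x\<in>{0..1}. regular_velocity T (\<lambda>u. V u x)) \<and>
    (\<forall>u. \<forall>x\<in>{0..1}. \<forall>x'\<in>{0..1}. \<forall>t\<in>{0..T}. \<bar>V u x t - V u x' t\<bar> \<le> W_modulus W x x')"

lemma regular_field_velocity: "regular_field V \<Longrightarrow> x \<in> {0..1} \<Longrightarrow> regular_velocity T (\<lambda>u. V u x)"
  by (simp add: regular_field_def)

text \<open>Time continuity holds because the velocity changes by at most the \<open>L\<^sup>1\<close> distance of the
  families.\<close>

lemma mean_field_regular:
  assumes m: "\<And>t. t \<in> {0..T} \<Longrightarrow> m t \<in> borel_measurable I_leb"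
    and cont: "\<And>t. t \<in> {0..T} \<Longrightarrow>
      ((\<lambda>s. LINT y|I_leb. dist (m s y) (m t y)) \<longlongrightarrow> 0) (at t within {0..T})"
  shows "regular_field (\<lambda>u x t. mean_field W D (m t) u x)"
  unfolding regular_field_def regular_velocity_def
proof (intro conjI ballI allI)
  fix x :: real assume x: "x \<in> {0..1}"
  show "continuous_on {0..T} (\<lambda>t. mean_field W D (m t) u x)" for u
    unfolding continuous_on
  proof
    fix t assume t: "t \<in> {0..T}"
    have "eventually (\<lambda>s. norm (mean_field W D (m s) u x - mean_field W D (m t) u x)
        \<le> (LINT y|I_leb. dist (m s y) (m t y))) (at t within {0..T})"
      unfolding eventually_at_filter
    proof (intro always_eventually allI impI)
      fix s assume s: "s \<in> {0..T}"
      show "norm (mean_field W D (m s) u x - mean_field W D (m t) u x)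
        \<le> (LINT y|I_leb. dist (m s y) (m t y))"
        using mean_field_diff_le_integral[OF m[OF s] m[OF t] x
            integrable_dist_circle_prob[OF m[OF s] m[OF t]] observe_lipschitz_measure]
        by simp
    qed
    from Lim_null_comparison[OF this cont[OF t]]
    show "((\<lambda>t. mean_field W D (m t) u x) \<longlongrightarrow> mean_field W D (m t) u x) (at t within {0..T})"
      by (simp add: LIM_zero_iff)
  qed
qed (use m mean_field_bound mean_field_diff_label
    mean_field_diff_le_const[OF m m _ observe_lipschitz_position] in auto)

end

section \<open>The fixed point operator on velocity fields\<close>

locale mean_field_problem = graphon_interaction +
  fixes m\<^sub>0 :: "real \<Rightarrow> circle_prob"
  assumes m\<^sub>0_meas: "m\<^sub>0 \<in> borel_measurable I_leb"
begin

definition transported :: "(circle \<Rightarrow> real \<Rightarrow> real \<Rightarrow> real) \<Rightarrow> real \<Rightarrow> real \<Rightarrow> circle_prob"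
  where "transported V t y = push (flow (\<lambda>u. V u y) T t 0) (m\<^sub>0 y)"

definition updated_field :: "(circle \<Rightarrow> real \<Rightarrow> real \<Rightarrow> real) \<Rightarrow> circle \<Rightarrow> real \<Rightarrow> real \<Rightarrow> real"
  where "updated_field V u x t = mean_field W D (transported V t) u x"

lemma regular_field_flow_lipschitz:
  assumes "regular_field V" "y \<in> {0..1}" "t \<in> {0..T}"
  shows "(3 / 2 * exp (3 * t))-lipschitz_on UNIV (flow (\<lambda>u. V u y) T t 0)"
  using assms T_pos by (intro flow_lipschitz regular_field_velocity)

text \<open>The flow at label y is Lipschitz in its initial point, and it depends continuously on y
  because by the comparison of flows its uniform distance to the flow at \<open>y'\<close> is controlled by the
  modulus of W. Hence pushing forward is continuous separately in the label and in the measure.\<close>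

lemma transported_measurable:
  assumes V: "regular_field V" and t: "t \<in> {0..T}"
  shows "transported V t \<in> borel_measurable I_leb"
  unfolding transported_def
proof (rule caratheodory_measurable[OF m\<^sub>0_meas])
  let ?\<Phi> = "\<lambda>y. flow (\<lambda>u. V u y) T t 0"
  note lip = regular_field_flow_lipschitz[OF V _ t]
  show "continuous_on UNIV (push (?\<Phi> y))" if y: "y \<in> {0..1}" for y
  proof (rule lipschitz_on_continuous_on)
    show "(3 / 2 * exp (3 * t))-lipschitz_on UNIV (push (?\<Phi> y))"
      by (rule lipschitz_onI, rule dist_push_measures_le[OF lip[OF y]]) simp_all
  qed
  show "continuous_on {0..1} (\<lambda>y. push (?\<Phi> y) \<mu>)" for \<mu>
    unfolding continuous_on
  proof
    fix y :: real assume y: "y \<in> {0..1}"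
    have "eventually (\<lambda>y'. norm (dist (push (?\<Phi> y') \<mu>) (push (?\<Phi> y) \<mu>))
        \<le> exp (3 * t) / 2 * W_modulus W y' y) (at y within {0..1})"
      unfolding eventually_at_filter
    proof (intro always_eventually allI impI)
      fix y' :: real assume y': "y' \<in> {0..1}"
      have nonneg: "W_modulus W y' y \<ge> 0" by (simp add: W_modulus_def)
      have near: "\<bar>V p y' r - V p y r\<bar> \<le> W_modulus W y' y * exp (3 * r)" if r: "r \<in> {0..T}" for p r
      proof -
        have "\<bar>V p y' r - V p y r\<bar> \<le> W_modulus W y' y * 1"
          using V y y' r by (simp add: regular_field_def)
        also have "\<dots> \<le> W_modulus W y' y * exp (3 * r)"
          using nonneg r by (intro mult_left_mono) auto
        finally show ?thesis .
      qed
      have "dist (?\<Phi> y' p) (?\<Phi> y p) \<le> (3 / 2 * dist p p + W_modulus W y' y / 2) * exp (3 * t)" for p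
        using flow_compare[OF regular_field_velocity[OF V y'] regular_field_velocity[OF V y] near t T_pos] .
      then have "dist (?\<Phi> y' p) (?\<Phi> y p) \<le> exp (3 * t) / 2 * W_modulus W y' y" for p
        by (simp add: mult.commute)
      from dist_push_maps_le[OF lip[OF y'] lip[OF y] this]
      show "norm (dist (push (?\<Phi> y') \<mu>) (push (?\<Phi> y) \<mu>)) \<le> exp (3 * t) / 2 * W_modulus W y' y"
        by simp
    qed
    moreover have "((\<lambda>y'. exp (3 * t) / 2 * W_modulus W y' y) \<longlongrightarrow> 0) (at y within {0..1})"
      using W_cont[OF y] by (rule tendsto_mult_right_zero)
    ultimately have "((\<lambda>y'. dist (push (?\<Phi> y') \<mu>) (push (?\<Phi> y) \<mu>)) \<longlongrightarrow> 0) (at y within {0..1})"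
      by (rule Lim_null_comparison)
    then show "((\<lambda>y'. push (?\<Phi> y') \<mu>) \<longlongrightarrow> push (?\<Phi> y) \<mu>) (at y within {0..1})"
      by (rule tendsto_dist_iff[THEN iffD2])
  qed
qed

lemma transported_speed:
  assumes V: "regular_field V" and st: "s \<in> {0..T}" "t \<in> {0..T}" and y: "y \<in> {0..1}"
  shows "dist (transported V t y) (transported V s y) \<le> \<bar>t - s\<bar>"
  unfolding transported_def
  by (rule dist_push_maps_le[OF regular_field_flow_lipschitz[OF V y st(2)]
        regular_field_flow_lipschitz[OF V y st(1)]])
    (rule flow_speed[OF regular_field_velocity[OF V y] T_pos st])

text \<open>The iteration takes place in the class of fields that are moreover 1-Lipschitz in time.
  Continuity in time would not pass to pointwise limits, whereas every condition below is a
  non-strict inequality between finitely many values.\<close>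

definition admissible_field :: "(circle \<Rightarrow> real \<Rightarrow> real \<Rightarrow> real) \<Rightarrow> bool"
  where "admissible_field V \<longleftrightarrow>
    (\<forall>u. \<forall>x\<in>{0..1}. \<forall>t\<in>{0..T}. \<bar>V u x t\<bar> \<le> 1) \<and>
    (\<forall>u u'. \<forall>x\<in>{0..1}. \<forall>t\<in>{0..T}. \<bar>V u x t - V u' x t\<bar> \<le> dist u u') \<and>
    (\<forall>u. \<forall>x\<in>{0..1}. \<forall>s\<in>{0..T}. \<forall>t\<in>{0..T}. \<bar>V u x t - V u x s\<bar> \<le> \<bar>t - s\<bar>) \<and>
    (\<forall>u. \<forall>x\<in>{0..1}. \<forall>x'\<in>{0..1}. \<forall>t\<in>{0..T}. \<bar>V u x t - V u x' t\<bar> \<le> W_modulus W x x')"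

lemma admissible_imp_regular:
  assumes "admissible_field V"
  shows "regular_field V"
proof -
  have "continuous_on {0..T} (V u x)" if "x \<in> {0..1}" for u x
  proof (rule lipschitz_on_continuous_on)
    show "1-lipschitz_on {0..T} (V u x)"
      using assms that by (intro lipschitz_onI) (auto simp: admissible_field_def dist_real_def)
  qed
  then show ?thesis
    using assms by (auto simp: admissible_field_def regular_field_def regular_velocity_def)
qed

text \<open>Updating improves continuity in time to Lipschitz continuity because points travel with
  speed at most 1; all other bounds come from those of W and D.\<close>

lemma updated_field_admissible:
  assumes V: "regular_field V"
  shows "admissible_field (updated_field V)"
proof -
  note m = transported_measurable[OF V]
  have "\<bar>updated_field V u x t - updated_field V u x s\<bar> \<le> \<bar>t - s\<bar>"
    if x: "x \<in> {0..1}" and st: "s \<in> {0..T}" "t \<in> {0..T}" for u x s t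
    unfolding updated_field_def
  proof (rule mean_field_diff_le_const[OF m[OF st(2)] m[OF st(1)] x])
    fix y :: real assume "y \<in> {0..1}"
    then show "\<bar>observe D u (transported V t y) - observe D u (transported V s y)\<bar> \<le> \<bar>t - s\<bar>"
      using observe_lipschitz_measure transported_speed[OF V st] order_trans by blast
  qed
  then show ?thesis
    using mean_field_bound[OF m] mean_field_diff_label[OF m]
      mean_field_diff_le_const[OF m m _ observe_lipschitz_position]
    unfolding admissible_field_def by (simp add: updated_field_def)
qed

lemma updated_field_contraction:
  assumes V: "regular_field V" and V': "regular_field V'"
    and near: "\<And>u x t. x \<in> {0..1} \<Longrightarrow> t \<in> {0..T} \<Longrightarrow> \<bar>V u x t - V' u x t\<bar> \<le> K * exp (3 * t)"
    and x: "x \<in> {0..1}" and t: "t \<in> {0..T}"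
  shows "\<bar>updated_field V u x t - updated_field V' u x t\<bar> \<le> K / 2 * exp (3 * t)"
  unfolding updated_field_def
proof (rule mean_field_diff_le_const[OF transported_measurable[OF V t] transported_measurable[OF V' t] x])
  fix y :: real assume y: "y \<in> {0..1}"
  have "dist (transported V t y) (transported V' t y) \<le> K / 2 * exp (3 * t)"
    unfolding transported_def
  proof (rule dist_push_maps_le[OF regular_field_flow_lipschitz[OF V y t] regular_field_flow_lipschitz[OF V' y t]])
    fix p
    have "dist (flow (\<lambda>u. V u y) T t 0 p) (flow (\<lambda>u. V' u y) T t 0 p)
        \<le> (3 / 2 * dist p p + K / 2) * exp (3 * t)"
      by (rule flow_compare[OF regular_field_velocity[OF V y] regular_field_velocity[OF V' y] near[OF y] t T_pos])
    then show "dist (flow (\<lambda>u. V u y) T t 0 p) (flow (\<lambda>u. V' u y) T t 0 p) \<le> K / 2 * exp (3 * t)"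
      by simp
  qed
  then show "\<bar>observe D u (transported V t y) - observe D u (transported V' t y)\<bar> \<le> K / 2 * exp (3 * t)"
    using observe_lipschitz_measure order_trans by blast
qed

text \<open>The fields are uncurried in order to be iterated as real-valued functions on the product of
  positions, labels and times; the start is the zero field.\<close>

lemma self_consistent_field_exists:
  "\<exists>V. regular_field V \<and> (\<forall>u. \<forall>x\<in>{0..1}. \<forall>t\<in>{0..T}. updated_field V u x t = V u x t)"
proof -
  define S where "S = (UNIV :: circle set) \<times> {0..1 :: real} \<times> {0..T}"
  define P where "P = {f. admissible_field (\<lambda>u x t. f (u, x, t))}"
  define F where "F f = (\<lambda>(u, x, t). updated_field (\<lambda>u x t. f (u, x, t)) u x t)" for f
  have reg: "regular_field (\<lambda>u x t. f (u, x, t))" if "f \<in> P" for f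
    using that by (simp add: P_def admissible_imp_regular)
  have "\<exists>f\<in>P. \<forall>z\<in>S. F f z = f z"
  proof (rule weighted_contraction_fixed_point[where \<rho> = "\<lambda>(u, x, t). exp (3 * t)"
        and ?f0.0 = "\<lambda>_. 0" and ?K0.0 = 1])
    fix f :: "nat \<Rightarrow> circle \<times> real \<times> real \<Rightarrow> real" and l
    assume f: "\<And>n. f n \<in> P" and l: "\<And>z. z \<in> S \<Longrightarrow> (\<lambda>n. f n z) \<longlonglongrightarrow> l z"
    have l: "(\<lambda>n. f n (u, x, t)) \<longlonglongrightarrow> l (u, x, t)" if "x \<in> {0..1}" "t \<in> {0..T}" for u x t
      using that by (intro l) (auto simp: S_def)
    have f1: "\<bar>f n (u, x, t)\<bar> \<le> 1"
      and f2: "\<bar>f n (u, x, t) - f n (u', x, t)\<bar> \<le> dist u u'"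
      if "x \<in> {0..1}" "t \<in> {0..T}" for n u u' x t
      using f[of n] that unfolding P_def admissible_field_def by auto
    have f3: "\<bar>f n (u, x, t) - f n (u, x, s)\<bar> \<le> \<bar>t - s\<bar>"
      if "x \<in> {0..1}" "s \<in> {0..T}" "t \<in> {0..T}" for n u x s t
      using f[of n] that unfolding P_def admissible_field_def by auto
    have f4: "\<bar>f n (u, x, t) - f n (u, x', t)\<bar> \<le> W_modulus W x x'"
      if "x \<in> {0..1}" "x' \<in> {0..1}" "t \<in> {0..T}" for n u x x' t
      using f[of n] that unfolding P_def admissible_field_def by auto
    show "l \<in> P"
      unfolding P_def admissible_field_def
    proof (intro CollectI conjI ballI allI)
      fix u u' and x t s x' :: real
      assume x: "x \<in> {0..1}"
      { assume t: "t \<in> {0..T}"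
        show "\<bar>l (u, x, t)\<bar> \<le> 1"
          by (rule LIMSEQ_le_const2[OF tendsto_rabs[OF l[OF x t]]]) (use f1[OF x t] in auto)
        show "\<bar>l (u, x, t) - l (u', x, t)\<bar> \<le> dist u u'"
          by (rule LIMSEQ_le_const2[OF tendsto_rabs[OF tendsto_diff[OF l[OF x t] l[OF x t]]]])
            (use f2[OF x t] in auto)
      }
      { assume s: "s \<in> {0..T}" and t: "t \<in> {0..T}"
        show "\<bar>l (u, x, t) - l (u, x, s)\<bar> \<le> \<bar>t - s\<bar>"
          by (rule LIMSEQ_le_const2[OF tendsto_rabs[OF tendsto_diff[OF l[OF x t] l[OF x s]]]])
            (use f3[OF x s t] in auto)
      }
      { assume x': "x' \<in> {0..1}" and t: "t \<in> {0..T}"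
        show "\<bar>l (u, x, t) - l (u, x', t)\<bar> \<le> W_modulus W x x'"
          by (rule LIMSEQ_le_const2[OF tendsto_rabs[OF tendsto_diff[OF l[OF x t] l[OF x' t]]]])
            (use f4[OF x x' t] in auto)
      }
    qed
  next
    fix f assume f: "f \<in> P"
    show "F f \<in> P"
      using updated_field_admissible[OF reg[OF f]] by (simp add: P_def F_def)
    fix g K z
    assume g: "g \<in> P" and near: "\<And>z. z \<in> S \<Longrightarrow> \<bar>f z - g z\<bar> \<le> K * (case z of (u, x, t) \<Rightarrow> exp (3 * t))"
      and z: "z \<in> S"
    obtain u x t where uxt: "z = (u, x, t)" "x \<in> {0..1}" "t \<in> {0..T}" using z by (auto simp: S_def)
    have "\<bar>updated_field (\<lambda>u x t. f (u, x, t)) u x t - updated_field (\<lambda>u x t. g (u, x, t)) u x t\<bar>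
        \<le> K / 2 * exp (3 * t)"
    proof (rule updated_field_contraction[OF reg[OF f] reg[OF g] _ uxt(2,3)])
      fix u and x t :: real assume "x \<in> {0..1}" "t \<in> {0..T}"
      then show "\<bar>f (u, x, t) - g (u, x, t)\<bar> \<le> K * exp (3 * t)"
        using near[of "(u, x, t)"] by (simp add: S_def)
    qed
    then show "\<bar>F f z - F g z\<bar> \<le> K / 2 * (case z of (u, x, t) \<Rightarrow> exp (3 * t))"
      by (simp add: uxt(1) F_def)
  next
    show 0: "(\<lambda>_. 0) \<in> P" by (simp add: P_def admissible_field_def W_modulus_def)
    fix z assume "z \<in> S"
    then obtain u x t where uxt: "z = (u, x, t)" "x \<in> {0..1}" "t \<in> {0..T}" by (auto simp: S_def)
    have "\<bar>F (\<lambda>_. 0) z\<bar> \<le> 1"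
      using updated_field_admissible[OF reg[OF 0]] uxt by (simp add: F_def admissible_field_def)
    also have "1 \<le> exp (3 * t)" using uxt(3) by simp
    finally show "\<bar>F (\<lambda>_. 0) z - 0\<bar> \<le> 1 * (case z of (u, x, t) \<Rightarrow> exp (3 * t))"
      using uxt(1) by simp
  qed
  then obtain f where "f \<in> P" "\<forall>z\<in>S. F f z = f z" by blast
  then show ?thesis
    using reg by (intro exI[of _ "\<lambda>u x t. f (u, x, t)"]) (auto simp: S_def F_def)
qed

text \<open>Two self-consistent fields are at weighted distance at most 2, and each application of the
  contraction halves this bound.\<close>

lemma self_consistent_field_unique:
  assumes V: "regular_field V" and V': "regular_field V'"
    and fix1: "\<And>u x t. x \<in> {0..1} \<Longrightarrow> t \<in> {0..T} \<Longrightarrow> updated_field V u x t = V u x t"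
    and fix2: "\<And>u x t. x \<in> {0..1} \<Longrightarrow> t \<in> {0..T} \<Longrightarrow> updated_field V' u x t = V' u x t"
    and x: "x \<in> {0..1}" and t: "t \<in> {0..T}"
  shows "V u x t = V' u x t"
proof -
  have near: "\<bar>V u x t - V' u x t\<bar> \<le> 2 / 2 ^ n * exp (3 * t)" if "x \<in> {0..1}" "t \<in> {0..T}" for n u x t
    using that
  proof (induction n arbitrary: u x t)
    case 0
    have "\<bar>V u x t\<bar> \<le> 1" "\<bar>V' u x t\<bar> \<le> 1"
      using V V' 0 by (simp_all add: regular_field_def regular_velocity_def)
    moreover have "1 \<le> exp (3 * t)" using 0 by simp
    ultimately have "\<bar>V u x t - V' u x t\<bar> \<le> 2 * exp (3 * t)" by linarith
    then show ?case by simp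
  next
    case (Suc n)
    from updated_field_contraction[OF V V' Suc.IH Suc.prems, of u] show ?case
      unfolding fix1[OF Suc.prems] fix2[OF Suc.prems] by simp
  qed
  have "(\<lambda>n. 2 * (1 / 2) ^ n * exp (3 * t)) \<longlonglongrightarrow> 2 * 0 * exp (3 * t)"
    by (intro tendsto_intros LIMSEQ_power_zero) simp
  then have "\<bar>V u x t - V' u x t\<bar> \<le> 2 * 0 * exp (3 * t)"
    by (rule LIMSEQ_le_const) (use near[OF x t] in \<open>auto simp: power_one_over\<close>)
  then show ?thesis by simp
qed

end

section \<open>Fixed point solutions and self-consistent fields\<close>

lemma abs_prob_family_eq_iff:
  assumes "f \<in> borel_measurable I_leb" "g \<in> borel_measurable I_leb"
  shows "abs_prob_family f = abs_prob_family g \<longleftrightarrow> (AE x in I_leb. f x = g x)"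
  using Quotient3_rel[OF Quotient3_prob_family, of f g] assms by simp

lemma version_exists: "\<exists>m. is_version m \<mu>"
  using Quotient3_rep_reflp[OF Quotient3_prob_family, of \<mu>]
    Quotient3_abs_rep[OF Quotient3_prob_family, of \<mu>]
  unfolding is_version_def by blast

lemma version_dist:
  assumes "is_version m \<mu>" "is_version n \<eta>"
  shows "dist \<mu> \<eta> = (LINT x|I_leb. dist (m x) (n x))"
  using assms dist_prob_family.abs_eq[of m n] by (auto simp: is_version_def)

lemma version_velocity:
  assumes "is_version m \<mu>"
  shows "velocity W D \<mu> u x = mean_field W D m u x"
  using assms velocity.abs_eq[of m W D] by (auto simp: is_version_def mean_field_def observe_def)

context mean_field_problem
begin

text \<open>The transported families form a curve whose velocity is the updated field, hence the given
  one; so the flow that moved the measures is the one generated by the curve itself. The equation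
  then holds for every label.\<close>

lemma self_consistent_field_solves:
  assumes V: "regular_field V"
    and fix_V: "\<And>u x t. x \<in> {0..1} \<Longrightarrow> t \<in> {0..T} \<Longrightarrow> updated_field V u x t = V u x t"
    and \<mu>\<^sub>0: "is_version m\<^sub>0 \<mu>\<^sub>0"
  defines "\<mu> \<equiv> restrict (\<lambda>t. abs_prob_family (transported V t)) {0..T}"
  shows "\<mu> \<in> curves T" "fixed_point_solution W D T \<mu>\<^sub>0 \<mu>"
proof -
  interpret I: prob_space I_leb by (rule prob_space_I_leb)
  note m = transported_measurable[OF V]
  have ver: "is_version (transported V t) (\<mu> t)" if "t \<in> {0..T}" for t
    using that m by (simp add: is_version_def \<mu>_def)
  have "dist (\<mu> s) (\<mu> t) \<le> 1 * dist s t" if st: "s \<in> {0..T}" "t \<in> {0..T}" for s t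
  proof -
    have "dist (\<mu> s) (\<mu> t) = (LINT y|I_leb. dist (transported V s y) (transported V t y))"
      by (rule version_dist[OF ver[OF st(1)] ver[OF st(2)]])
    also have "\<dots> \<le> (LINT y|I_leb. \<bar>s - t\<bar>)"
      using transported_speed[OF V st(2) st(1)]
      by (intro integral_mono integrable_dist_circle_prob m st) auto
    finally show ?thesis using I.prob_space by (simp add: dist_real_def)
  qed
  then have "1-lipschitz_on {0..T} \<mu>" by (intro lipschitz_onI) auto
  then show "\<mu> \<in> curves T"
    unfolding curves_def using lipschitz_on_continuous_on by (auto simp: \<mu>_def)
  have "meas (transported V t x) = distr (meas (m\<^sub>0 x)) borel (flowW W D T \<mu> x t 0)"
    if x: "x \<in> {0..1}" and t: "t \<in> {0..T}" for x t
  proof -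
    have "flow (\<lambda>u t. velocity W D (\<mu> t) u x) T = flow (\<lambda>u. V u x) T"
      by (rule flow_cong)
        (use fix_V[OF x] in \<open>simp add: version_velocity[OF ver] updated_field_def\<close>)
    then have "flowW W D T \<mu> x t 0 = flow (\<lambda>u. V u x) T t 0" by (simp add: flowW_def)
    then show ?thesis
      using meas_push[OF lipschitz_circle_map_measurable[OF regular_field_flow_lipschitz[OF V x t]]]
      by (simp add: transported_def)
  qed
  then show "fixed_point_solution W D T \<mu>\<^sub>0 \<mu>"
    unfolding fixed_point_solution_def using \<mu>\<^sub>0 ver
    by (intro exI[of _ m\<^sub>0] exI[of _ "transported V"] conjI ballI AE_I2) simp_all
qed

text \<open>The converse. For almost every label the solution is the transported initial measure, and
  null sets of labels affect neither the mean-field integral nor the classes that make up the curve.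
  A solution is thus recovered from its velocity field, so uniqueness for fields gives uniqueness
  for curves.\<close>

lemma solution_velocity_self_consistent:
  assumes curve: "\<mu> \<in> curves T" and sol: "fixed_point_solution W D T \<mu>\<^sub>0 \<mu>"
    and \<mu>\<^sub>0: "is_version m\<^sub>0 \<mu>\<^sub>0"
  defines "V \<equiv> \<lambda>u x t. velocity W D (\<mu> t) u x"
  shows "regular_field V"
    and "\<And>u x t. x \<in> {0..1} \<Longrightarrow> t \<in> {0..T} \<Longrightarrow> updated_field V u x t = V u x t"
    and "\<And>t. t \<in> {0..T} \<Longrightarrow> \<mu> t = abs_prob_family (transported V t)"
proof -
  obtain n\<^sub>0 m where n\<^sub>0: "is_version n\<^sub>0 \<mu>\<^sub>0" and m: "\<And>t. t \<in> {0..T} \<Longrightarrow> is_version (m t) (\<mu> t)"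
    and eq: "AE x in I_leb. \<forall>t\<in>{0..T}. meas (m t x) = distr (meas (n\<^sub>0 x)) borel (flowW W D T \<mu> x t 0)"
    using sol unfolding fixed_point_solution_def by blast
  have meas: "m t \<in> borel_measurable I_leb" if "t \<in> {0..T}" for t
    using m[OF that] by (simp add: is_version_def)
  have V_eq: "V u x t = mean_field W D (m t) u x" if "t \<in> {0..T}" for u x t
    unfolding V_def by (rule version_velocity[OF m[OF that]])
  have "regular_field (\<lambda>u x t. mean_field W D (m t) u x)"
  proof (rule mean_field_regular[OF meas])
    fix t assume t: "t \<in> {0..T}"
    have "((\<lambda>s. dist (\<mu> s) (\<mu> t)) \<longlongrightarrow> 0) (at t within {0..T})"
      using curve t by (intro tendsto_dist_iff[THEN iffD1]) (auto simp: curves_def continuous_on)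
    moreover have "eventually (\<lambda>s. dist (\<mu> s) (\<mu> t) = (LINT y|I_leb. dist (m s y) (m t y)))
        (at t within {0..T})"
      unfolding eventually_at_filter
      by (intro always_eventually allI impI version_dist m t)
    ultimately show "((\<lambda>s. LINT y|I_leb. dist (m s y) (m t y)) \<longlongrightarrow> 0) (at t within {0..T})"
      by (rule Lim_transform_eventually)
  qed
  moreover have "continuous_on {0..T} (V u x) \<longleftrightarrow>
      continuous_on {0..T} (\<lambda>t. mean_field W D (m t) u x)" for u x
    by (rule continuous_on_cong) (simp_all add: V_eq)
  ultimately show V: "regular_field V"
    by (simp add: regular_field_def regular_velocity_def V_eq)
  have "AE x in I_leb. m\<^sub>0 x = n\<^sub>0 x"
    using \<mu>\<^sub>0 n\<^sub>0 abs_prob_family_eq_iff[of m\<^sub>0 n\<^sub>0] by (simp add: is_version_def)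
  then have trans: "AE x in I_leb. \<forall>t\<in>{0..T}. m t x = transported V t x"
    using eq AE_space
  proof eventually_elim
    case (elim x)
    show ?case
    proof
      fix t assume t: "t \<in> {0..T}"
      have x: "x \<in> {0..1}" using elim(3) by simp
      have "meas (transported V t x) = distr (meas (m\<^sub>0 x)) borel (flow (\<lambda>u. V u x) T t 0)"
        unfolding transported_def
        by (rule meas_push[OF lipschitz_circle_map_measurable[OF regular_field_flow_lipschitz[OF V x t]]])
      then have "meas (m t x) = meas (transported V t x)"
        using elim(1,2) t by (simp add: flowW_def V_def)
      then show "m t x = transported V t x" by (simp add: meas_inject)
    qed
  qed
  show "updated_field V u x t = V u x t" if "x \<in> {0..1}" "t \<in> {0..T}" for u x t
    unfolding updated_field_def V_eq[OF that(2)] mean_field_def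
    by (rule integral_I_leb_cong_AE) (use trans that in \<open>auto elim: AE_mp\<close>)
  show "\<mu> t = abs_prob_family (transported V t)" if t: "t \<in> {0..T}" for t
  proof -
    have "AE x in I_leb. m t x = transported V t x" using trans t by auto
    then show ?thesis
      using abs_prob_family_eq_iff[OF meas[OF t] transported_measurable[OF V t]] m[OF t]
      by (simp add: is_version_def)
  qed
qed

end

theorem theorem2p4:
  fixes W :: "real \<Rightarrow> real \<Rightarrow> real" and D :: "circle \<Rightarrow> real" and T :: real
    and \<mu>\<^sub>0 :: prob_family
  assumes W_sym: "\<And>x y. x \<in> {0..1} \<Longrightarrow> y \<in> {0..1} \<Longrightarrow> W x y = W y x"
    and W_meas: "(\<lambda>(x, y). W x y) \<in> borel_measurable (lebesgue_on ({0..1} \<times> {0..1}))"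
    and W_section_meas: "\<And>x. x \<in> {0..1} \<Longrightarrow> W x \<in> borel_measurable (lebesgue_on {0..1})"
    and W_bound: "\<And>x y. x \<in> {0..1} \<Longrightarrow> y \<in> {0..1} \<Longrightarrow> \<bar>W x y\<bar> \<le> 1"
    and W_cont: "\<And>x. x \<in> {0..1} \<Longrightarrow>
      ((\<lambda>\<delta>. LINT y|lebesgue_on {0..1}. \<bar>W (x + \<delta>) y - W x y\<bar>) \<longlongrightarrow> 0)
        (at 0 within {\<delta>. x + \<delta> \<in> {0..1}})"
    and D_bound: "\<And>u. \<bar>D u\<bar> \<le> 1"
    and D_lipschitz: "\<And>u v :: real. \<bar>D (abs_circle u) - D (abs_circle v)\<bar> \<le> \<bar>u - v\<bar>"
    and T_pos: "T > 0"
  shows "\<exists>!\<mu>. \<mu> \<in> curves T \<and> fixed_point_solution W D T \<mu>\<^sub>0 \<mu>"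
proof -
  obtain m\<^sub>0 where m\<^sub>0: "is_version m\<^sub>0 \<mu>\<^sub>0" using version_exists by blast
  interpret mean_field_problem W D T m\<^sub>0
  proof
    show "((\<lambda>x'. W_modulus W x' x) \<longlongrightarrow> 0) (at x within {0..1})" if x: "x \<in> {0..1}" for x
      unfolding Lim_within
    proof (intro allI impI)
      fix e :: real assume "e > 0"
      then obtain d where d: "d > 0" "\<And>\<delta>. x + \<delta> \<in> {0..1} \<Longrightarrow> 0 < dist \<delta> 0 \<Longrightarrow> dist \<delta> 0 < d \<Longrightarrow>
          dist (LINT y|I_leb. \<bar>W (x + \<delta>) y - W x y\<bar>) 0 < e"
        using W_cont[OF x] unfolding Lim_within by blast
      have "dist (W_modulus W x' x) 0 < e" if "x' \<in> {0..1}" "0 < dist x' x" "dist x' x < d" for x'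
        using d(2)[of "x' - x"] that by (simp add: W_modulus_def dist_real_def)
      with d(1) show "\<exists>d>0. \<forall>x'\<in>{0..1}. 0 < dist x' x \<and> dist x' x < d \<longrightarrow>
          dist (W_modulus W x' x) 0 < e" by blast
    qed
    show "1-lipschitz_on UNIV D"
    proof (rule lipschitz_onI)
      fix p q
      obtain a b where "p = abs_circle a" "q = abs_circle b" "\<bar>a - b\<bar> = dist p q"
        by (rule circle_lifts_at_distance)
      then show "dist (D p) (D q) \<le> 1 * dist p q"
        using D_lipschitz[of a b] by (simp add: dist_real_def)
    qed simp
    show "m\<^sub>0 \<in> borel_measurable I_leb" using m\<^sub>0 by (simp add: is_version_def)
  qed (fact W_section_meas W_bound D_bound T_pos)+
  show ?thesis
  proof (rule ex_ex1I)
    show "\<exists>\<mu>. \<mu> \<in> curves T \<and> fixed_point_solution W D T \<mu>\<^sub>0 \<mu>"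
      using self_consistent_field_exists self_consistent_field_solves[OF _ _ m\<^sub>0] by blast
  next
    fix \<mu> \<eta>
    assume \<mu>: "\<mu> \<in> curves T \<and> fixed_point_solution W D T \<mu>\<^sub>0 \<mu>"
      and \<eta>: "\<eta> \<in> curves T \<and> fixed_point_solution W D T \<mu>\<^sub>0 \<eta>"
    note sc\<mu> = solution_velocity_self_consistent[OF conjunct1[OF \<mu>] conjunct2[OF \<mu>] m\<^sub>0]
    note sc\<eta> = solution_velocity_self_consistent[OF conjunct1[OF \<eta>] conjunct2[OF \<eta>] m\<^sub>0]
    have V: "velocity W D (\<mu> t) u x = velocity W D (\<eta> t) u x"
      if "x \<in> {0..1}" "t \<in> {0..T}" for u x t
      using self_consistent_field_unique[OF sc\<mu>(1) sc\<eta>(1) sc\<mu>(2) sc\<eta>(2) that] .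
    have "\<mu> t = \<eta> t" if t: "t \<in> {0..T}" for t
    proof -
      have "flow (\<lambda>u t. velocity W D (\<mu> t) u x) T = flow (\<lambda>u t. velocity W D (\<eta> t) u x) T"
        if "x \<in> {0..1}" for x
        by (rule flow_cong) (rule V[OF that])
      then have "AE x in I_leb. transported (\<lambda>u x t. velocity W D (\<mu> t) u x) t x
          = transported (\<lambda>u x t. velocity W D (\<eta> t) u x) t x"
        by (intro AE_I2) (simp add: transported_def)
      then show ?thesis
        unfolding sc\<mu>(3)[OF t] sc\<eta>(3)[OF t]
        using abs_prob_family_eq_iff transported_measurable[OF sc\<mu>(1) t] transported_measurable[OF sc\<eta>(1) t]
        by simp
    qed
    then show "\<mu> = \<eta>" using \<mu> \<eta> by (intro extensionalityI[of \<mu> "{0..T}"]) (auto simp: curves_def)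
  qed
qed

end
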